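(* (i) Let $F=\{f_1,\dots,f_k\}$ be a system of tropical polynomials in $n$ variables over the semiring $\mathbb{R}$, let $d_i=\deg(f_i)$, and let $N=(n+2)(d_1+\dots+d_k)$. Then $F$ has no root in $\mathbb{R}^n$ if and only if there is a nonsingular algebraic combination $g$ of $F$ of degree at most $N$. (ii) There is a fixed polynomial $p$ with the following property. Let $F=\{f_1,\dots,f_k\}$ be any system of tropical polynomials in $n$ variables over the semiring $\mathbb{R}_\infty$, let $d=\max_i\deg(f_i)$, and let $N=p(n,k,d)\,(4d)^{\min(n,k)}$. Then $F$ has no root in $\mathbb{R}_\infty^n$ if and only if there is a nonsingular algebraic combination $g$ of $F$ of degree at most $N$ and with a finite constant monomial.
   Context: $\mathbb{R}_\infty=\mathbb{R}\cup\{+\infty\}$. Tropical operations on $\mathbb{K}\in\{\mathbb{R},\mathbb{R}_\infty\}$: $x\oplus y=\min\{x,y\}$, $x\odot y=x+y$. A tropical monomial is $m(\vec x)=c\odot \vec x^{I}$ with $c\in\mathbb{K}$, $I=(i_1,\dots,i_n)\in\mathbb{Z}_{\ge0}^n$ and $\vec x^{I}=i_1x_1+\dots+i_nx_n$ in classical notation (with $0\cdot\infty=0$); its degree is $|I|=i_1+\dots+i_n$. A tropical polynomial is a finite tropical sum $f=\bigoplus_i m_i=\min_i m_i$ of monomials with pairwise distinct exponent vectors; its degree is the maximal degree of its monomials. A point $\vec a\in\mathbb{K}^n$ is a root of $f$ if $\min_i m_i(\vec a)$ is attained on at least two different monomials or is equal to $\infty$. A root of a system is a common root of all its polynomials. Given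 tropical monomials $m_1,\dots,m_K$ ($K\ge1$, with finite coefficients) and indices $i_1,\dots,i_K\in\{1,\dots,k\}$, the algebraic combination $g=\bigoplus_{j=1}^{K}g_j$ with $g_j=m_j\odot f_{i_j}$ (for each exponent vector the minimum of the coefficients is taken; the coefficient of an absent monomial is $\infty$, and the monomials of a polynomial are those with finite coefficient) is called nonsingular if: (1) for each monomial $m$ of $g$ there is a (unique) index $1\le l(m)\le K$ such that the coefficient of $m$ in $g_{l(m)}$ is less than the coefficients of $m$ in all other $g_j$, $j\ne l(m)$; (2) for different monomials $m\neq m'$ of $g$ one has $l(m)\ne l(m')$. *)

theory Defs
  imports "HOL-Library.Extended_Real" "HOL-Computational_Algebra.Polynomial"
begin

text \<open>
  The number of variables \<open>n\<close> is quantified inside formulas, so vectors are functions on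
  \<^typ>\<open>nat\<close>, of which only the coordinates \<open>0, \<dots>, n - 1\<close> count. Exponent vectors are
  normalised to be zero elsewhere, so that distinct functions are distinct exponent vectors.
\<close>

type_synonym expo = "nat \<Rightarrow> nat"

definition exponents :: "nat \<Rightarrow> expo set" where
  "exponents n = {I. \<forall>v\<ge>n. I v = 0}"

text \<open>
  The semiring of reals with \<open>\<infinity>\<close> is the part of \<^typ>\<open>ereal\<close> without \<open>-\<infinity>\<close>; in
  \<^typ>\<open>ereal\<close> one has \<open>0 * \<infinity> = 0\<close>. A tropical polynomial is its coefficient function;
  the coefficient \<open>\<infinity>\<close> means that the monomial is absent.
\<close>

type_synonym tpoly = "expo \<Rightarrow> ereal"

definition monomials :: "tpoly \<Rightarrow> expo set" where
  "monomials f = {I. f I \<noteq> \<infinity>}"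

definition tpoly_Rinf :: "nat \<Rightarrow> tpoly \<Rightarrow> bool" where
  "tpoly_Rinf n f \<longleftrightarrow> finite (monomials f) \<and> monomials f \<subseteq> exponents n \<and> (\<forall>I. f I \<noteq> -\<infinity>)"

text \<open>Over the reals there is no coefficient \<open>\<infinity>\<close>, so the sum has at least one actual term.\<close>

definition tpoly_R :: "nat \<Rightarrow> tpoly \<Rightarrow> bool" where
  "tpoly_R n f \<longleftrightarrow> tpoly_Rinf n f \<and> monomials f \<noteq> {}"

definition tdegree :: "nat \<Rightarrow> tpoly \<Rightarrow> nat" where
  "tdegree n f = Max (insert 0 ((\<lambda>I. \<Sum>v<n. I v) ` monomials f))"

definition mono_value :: "nat \<Rightarrow> tpoly \<Rightarrow> expo \<Rightarrow> (nat \<Rightarrow> ereal) \<Rightarrow> ereal" where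
  "mono_value n f I a = f I + (\<Sum>v<n. ereal (real (I v)) * a v)"

text \<open>The infimum over the empty set is \<open>\<infinity>\<close>, the tropical zero.\<close>

definition tvalue :: "nat \<Rightarrow> tpoly \<Rightarrow> (nat \<Rightarrow> ereal) \<Rightarrow> ereal" where
  "tvalue n f a = (INF I\<in>monomials f. mono_value n f I a)"

definition troot :: "nat \<Rightarrow> tpoly \<Rightarrow> (nat \<Rightarrow> ereal) \<Rightarrow> bool" where
  "troot n f a \<longleftrightarrow> tvalue n f a = \<infinity> \<or>
     (\<exists>I\<in>monomials f. \<exists>J\<in>monomials f. I \<noteq> J \<and>
        mono_value n f I a = tvalue n f a \<and> mono_value n f J a = tvalue n f a)"

text \<open>A system of \<open>k\<close> polynomials is \<open>F 0, \<dots>, F (k - 1)\<close>.\<close>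

definition has_root_R :: "nat \<Rightarrow> nat \<Rightarrow> (nat \<Rightarrow> tpoly) \<Rightarrow> bool" where
  "has_root_R n k F \<longleftrightarrow> (\<exists>a :: nat \<Rightarrow> real. \<forall>i<k. troot n (F i) (\<lambda>v. ereal (a v)))"

definition has_root_Rinf :: "nat \<Rightarrow> nat \<Rightarrow> (nat \<Rightarrow> tpoly) \<Rightarrow> bool" where
  "has_root_Rinf n k F \<longleftrightarrow>
     (\<exists>a :: nat \<Rightarrow> ereal. (\<forall>v<n. a v \<noteq> -\<infinity>) \<and> (\<forall>i<k. troot n (F i) a))"

definition max_degree :: "nat \<Rightarrow> nat \<Rightarrow> (nat \<Rightarrow> tpoly) \<Rightarrow> nat" where
  "max_degree n k F = Max (insert 0 ((\<lambda>i. tdegree n (F i)) ` {..<k}))"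

text \<open>Tropical product of the monomial with real coefficient \<open>c\<close> and exponent \<open>E\<close> with \<open>f\<close>.\<close>

definition mono_mult :: "real \<Rightarrow> expo \<Rightarrow> tpoly \<Rightarrow> tpoly" where
  "mono_mult c E f = (\<lambda>I. if E \<le> I then ereal c + f (\<lambda>v. I v - E v) else \<infinity>)"

definition tsum :: "nat \<Rightarrow> (nat \<Rightarrow> tpoly) \<Rightarrow> tpoly" where
  "tsum K G = (\<lambda>I. Min ((\<lambda>j. G j I) ` {..<K}))"

definition nonsingular :: "nat \<Rightarrow> (nat \<Rightarrow> tpoly) \<Rightarrow> bool" where
  "nonsingular K G \<longleftrightarrow>
     (\<exists>l. (\<forall>I\<in>monomials (tsum K G). l I < K \<and> (\<forall>j<K. j \<noteq> l I \<longrightarrow> G (l I) I < G j I)) \<and>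
          inj_on l (monomials (tsum K G)))"

definition nonsingular_combination :: "nat \<Rightarrow> nat \<Rightarrow> (nat \<Rightarrow> tpoly) \<Rightarrow> tpoly \<Rightarrow> bool" where
  "nonsingular_combination n k F g \<longleftrightarrow>
     (\<exists>K c E s. K \<ge> 1 \<and> (\<forall>j<K. E j \<in> exponents n \<and> s j < k) \<and>
        g = tsum K (\<lambda>j. mono_mult (c j) (E j) (F (s j))) \<and>
        nonsingular K (\<lambda>j. mono_mult (c j) (E j) (F (s j))))"

text \<open>Polynomials in three variables as iterated univariate ones.\<close>

definition poly3 :: "real poly poly poly \<Rightarrow> real \<Rightarrow> real \<Rightarrow> real \<Rightarrow> real" where
  "poly3 p x y z = poly (poly (poly p [:[:z:]:]) [:y:]) x"

end

theory Submission
  imports Defs "HOL-Analysis.Function_Topology"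
begin

text \<open>
  A root of the system gives a solution \<open>y J = a \<bullet> J\<close> of the tropical linear system, the Macaulay system,
  formed by all multiples \<open>x\<^sup>E \<odot> f\<^sub>i\<close> of degree at most \<open>N\<close>. The proof has two parts: a duality for
  tropical linear systems, and the converse that a solution of the Macaulay system of sufficiently
  large degree forces a root.
  
  Duality (\<open>linear_duality\<close>, \<open>macaulay_alternative\<close>). A tropical linear system has a solution whose infinite
  columns are exactly the columns of a nonsingular combination of rows: raise coordinates as long as
  some row has a strict minimum there; the coordinates that stay bounded converge to a solution, and
  those that can be raised indefinitely have distinct witness rows that form the combination.
  If there is no solution that is finite everywhere (over the reals), or finite at the constant monomial
  (with \<open>\<infinity>\<close> allowed), the combination is nonempty, or contains the constant monomial. That a nonsingular
  combination excludes roots is the elementary direction, \<open>nonsingular_combination_excludes_root\<close>.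
  
  From solutions to roots (\<open>touching_mixture\<close>). View the coefficients of \<open>f\<^sub>i\<close> as heights over its exponents,
  and the solution \<open>y\<close> as heights over the exponents of degree at most \<open>N\<close>. Push a dilated copy of
  the Minkowski sum of the (negated) lifted Newton polytopes against the graph of \<open>y\<close> until it touches.
  At a touching point that lies in the relative interior of a cell of largest dimension, a slope \<open>a\<close>
  dual to the cell is a root: otherwise the cell has a single vertex \<open>v\<close> in the direction of some \<open>f\<^sub>i\<close>,
  the row through the touching point has its minimum at \<open>v\<close>, and the second minimum of this row would be
  a touching point with a larger cell. Over the reals this applies to all polynomials at once, in degree
  linear in the sum of the degrees.
  
  With \<open>\<infinity>\<close> allowed, \<open>y\<close> may be infinite at most exponents, and variables have to be sent to \<open>\<infinity>\<close>. For a set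
  \<open>U\<close> of variables that are kept finite, the touching argument with the monomials in \<open>U\<close> yields a root,
  or it moves from an exponent where \<open>y\<close> is finite to another one by removing a monomial in \<open>U\<close> and adding
  a monomial that leaves \<open>U\<close>. The set \<open>U\<close> is chosen anew at every step as the set of cheap variables, where
  prices are the derivatives of a bounded concave potential, and the choice (\<open>price_gap\<close>) guarantees that
  what is removed is cheaper than what is added. So the potential grows by a definite amount, about
  \<open>(2 d)\<close> to the power \<open>- min n k\<close>, in every step (\<open>potential_step\<close>), and since it is bounded, a root must
  appear before the degree exceeds \<open>N\<close>.
\<close>

section \<open>Duality for tropical linear systems\<close>

text \<open>
  A nonnegative vector is self-certified if every positive coordinate \<open>m\<close> is witnessed by a row in which
  column \<open>m\<close> is still the strict minimum: the coordinate has been raised from \<open>0\<close>, and raising it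
  has not yet made that row balanced. Such vectors approach a tropical solution from below wherever
  they stay bounded.
\<close>

definition self_certified :: "'c set \<Rightarrow> 'r set \<Rightarrow> ('r \<Rightarrow> 'c \<Rightarrow> real) \<Rightarrow> ('r \<Rightarrow> 'c set) \<Rightarrow> ('c \<Rightarrow> real) \<Rightarrow> bool" where
  "self_certified C R A Sp y \<longleftrightarrow>
     (\<forall>m\<in>C. 0 \<le> y m \<and>
        (0 < y m \<longrightarrow> (\<exists>r\<in>R. m \<in> Sp r \<and> (\<forall>m'\<in>Sp r - {m}. A r m + y m < A r m' + y m'))))"

text \<open>
  The larger of two values keeps its own witness, because the other columns only grow.
\<close>

lemma self_certified_max:
  assumes "self_certified C R A Sp y" "self_certified C R A Sp z" "\<And>r. r \<in> R \<Longrightarrow> Sp r \<subseteq> C"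
  shows "self_certified C R A Sp (\<lambda>m. max (y m) (z m))"
  unfolding self_certified_def
proof (intro ballI conjI impI)
  fix m assume m: "m \<in> C"
  show "0 \<le> max (y m) (z m)" using assms(1) m by (auto simp: self_certified_def)
  assume pos: "0 < max (y m) (z m)"
  show "\<exists>r\<in>R. m \<in> Sp r \<and> (\<forall>m'\<in>Sp r - {m}. A r m + max (y m) (z m) < A r m' + max (y m') (z m'))"
  proof (cases "z m \<le> y m")
    case True
    then obtain r where "r \<in> R" "m \<in> Sp r" "\<forall>m'\<in>Sp r - {m}. A r m + y m < A r m' + y m'"
      using assms(1) m pos by (auto simp: self_certified_def max_def)
    then show ?thesis using True by (intro bexI[of _ r] conjI ballI) (auto simp: max_absorb1 intro: order.strict_trans2[OF _ add_left_mono])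
  next
    case False
    then obtain r where "r \<in> R" "m \<in> Sp r" "\<forall>m'\<in>Sp r - {m}. A r m + z m < A r m' + z m'"
      using assms(2) m pos by (auto simp: self_certified_def max_def split: if_splits)
    then show ?thesis using False by (intro bexI[of _ r] conjI ballI) (auto simp: max_absorb2 intro: order.strict_trans2[OF _ add_left_mono])
  qed
qed

lemma self_certified_simultaneous:
  assumes Sp: "\<And>r. r \<in> R \<Longrightarrow> Sp r \<subseteq> C"
  assumes "finite C'" "\<And>m. m \<in> C' \<Longrightarrow> \<exists>y. self_certified C R A Sp y \<and> \<tau> m < y m"
  shows "\<exists>y. self_certified C R A Sp y \<and> (\<forall>m\<in>C'. \<tau> m < y m)"
  using assms(2,3)
proof (induction C')
  case empty
  have "self_certified C R A Sp (\<lambda>_. 0)" by (auto simp: self_certified_def)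
  then show ?case by auto
next
  case (insert a C')
  then obtain y where y: "self_certified C R A Sp y" "\<forall>m\<in>C'. \<tau> m < y m" by auto
  obtain z where z: "self_certified C R A Sp z" "\<tau> a < z a" using insert.prems by auto
  show ?case
    by (rule exI[of _ "\<lambda>m. max (y m) (z m)"])
       (use y z self_certified_max[OF y(1) z(1) Sp] in \<open>auto simp: less_max_iff_disj\<close>)
qed

text \<open>
  Duality for tropical linear systems with rows \<open>r\<close>, of support \<open>Sp r\<close> and coefficients \<open>A r\<close>. Take
  the supremum \<open>y\<close> of all self-certified vectors, and let \<open>D\<close> be the columns where it is finite. If some
  row had a strict minimum of \<open>A r + y\<close> at a column \<open>m\<close> of \<open>D\<close>, a self-certified vector close to the
  supremum (and large outside \<open>D\<close>) could be raised at \<open>m\<close> beyond \<open>y m\<close>, with that row as witness. So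
  \<open>y\<close>, with value \<open>\<infinity>\<close> outside \<open>D\<close>, is a solution. Conversely, a self-certified vector \<open>u\<close> that is
  large outside \<open>D\<close> gives every column outside \<open>D\<close> a witness row, and the support of that row avoids
  \<open>D\<close>, where \<open>u\<close> is bounded by \<open>y\<close>.
\<close>

theorem linear_duality:
  fixes A :: "'r \<Rightarrow> 'c \<Rightarrow> real"
  assumes "finite C" "finite R" and Sp: "\<And>r. r \<in> R \<Longrightarrow> Sp r \<subseteq> C"
  obtains D y u where "D \<subseteq> C"
    "\<And>r m. r \<in> R \<Longrightarrow> m \<in> Sp r \<Longrightarrow> m \<in> D \<Longrightarrow>
       \<exists>m'\<in>Sp r. m' \<noteq> m \<and> m' \<in> D \<and> A r m' + y m' \<le> A r m + (y m :: real)"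
    "\<And>m. m \<in> C - D \<Longrightarrow>
       \<exists>r\<in>R. m \<in> Sp r \<and> Sp r \<subseteq> C - D \<and> (\<forall>m'\<in>Sp r - {m}. A r m + u m < A r m' + (u m' :: real))"
proof -
  define V where "V m = {y m | y. self_certified C R A Sp y}" for m
  define D where "D = {m\<in>C. bdd_above (V m)}"
  define y where "y m = Sup (V m)" for m
  have upper: "z m \<le> y m" if "self_certified C R A Sp z" "m \<in> D" for z m
    unfolding y_def using that by (intro cSup_upper) (auto simp: V_def D_def)
  have ne: "V m \<noteq> {}" for m
    using self_certified_simultaneous[of R Sp C "{}" A "\<lambda>_. 0"] Sp by (auto simp: V_def)
  have large: "\<exists>z. self_certified C R A Sp z \<and> (\<forall>m\<in>C. (if m \<in> D then y m - e else B m) < z m)"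
    if "e > 0" for e :: real and B :: "'c \<Rightarrow> real"
  proof (rule self_certified_simultaneous[OF Sp \<open>finite C\<close>], assumption)
    fix m assume m: "m \<in> C"
    show "\<exists>z. self_certified C R A Sp z \<and> (if m \<in> D then y m - e else B m) < z m"
    proof (cases "m \<in> D")
      case True
      then have "y m - e < Sup (V m)" using that by (simp add: y_def)
      then obtain t where "t \<in> V m" "y m - e < t" using less_cSupD[OF ne] by blast
      then show ?thesis using True by (auto simp: V_def)
    next
      case False
      then obtain t where "t \<in> V m" "B m < t" using m by (force simp: D_def bdd_above_def not_le)
      then show ?thesis using False by (auto simp: V_def)
    qed
  qed
  define bs where "bs = insert 0 ((\<lambda>(r, m, m'). A r m' + y m' - A r m) ` (R \<times> C \<times> C))"
  define b where "b = Max bs"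
  have finbs: "finite bs" unfolding bs_def using assms(1,2) by auto
  have b0: "0 \<le> b" unfolding b_def using finbs by (intro Max_ge) (auto simp: bs_def)
  obtain u where u: "self_certified C R A Sp u" "\<forall>m\<in>C. (if m \<in> D then y m - 1 else b) < u m"
    using large[of 1 "\<lambda>_. b"] by auto
  show ?thesis
  proof
    show "D \<subseteq> C" by (auto simp: D_def)
  next
    fix r m assume r: "r \<in> R" and m: "m \<in> Sp r" "m \<in> D"
    show "\<exists>m'\<in>Sp r. m' \<noteq> m \<and> m' \<in> D \<and> A r m' + y m' \<le> A r m + y m"
    proof (rule ccontr)
      assume "\<not> ?thesis"
      then have gap: "0 < A r m' + y m' - (A r m + y m)" if "m' \<in> Sp r \<inter> D - {m}" for m'
        using that by force
      have fin: "finite (Sp r \<inter> D - {m})"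
        using Sp[OF r] \<open>finite C\<close> by (meson finite_Diff finite_Int finite_subset)
      define g where "g = Min (insert 1 ((\<lambda>m'. A r m' + y m' - (A r m + y m)) ` (Sp r \<inter> D - {m})))"
      have g: "g > 0" "\<And>m'. m' \<in> Sp r \<inter> D - {m} \<Longrightarrow> A r m + y m + g \<le> A r m' + y m'"
      proof -
        show "g > 0" unfolding g_def using fin gap by (subst Min_gr_iff) auto
        fix m' assume m': "m' \<in> Sp r \<inter> D - {m}"
        then have "g \<le> A r m' + y m' - (A r m + y m)"
          unfolding g_def using fin by (intro Min_le) auto
        then show "A r m + y m + g \<le> A r m' + y m'" by simp
      qed
      obtain z where z: "self_certified C R A Sp z"
        "\<And>m'. m' \<in> C \<Longrightarrow> (if m' \<in> D then y m' - g/4 else A r m + y m + g - A r m') < z m'"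
        using large[of "g/4"  "\<lambda>m'. A r m + y m + g - A r m'"] g by auto
      have z0: "m' \<in> C \<Longrightarrow> z m' \<ge> 0" for m' using z(1) by (auto simp: self_certified_def)
      \<comment> \<open>The increment exceeds the distance \<open>g/4\<close> to the supremum but keeps the row within its gap \<open>g\<close>.\<close>
      let ?z = "z(m := z m + g/2)"
      have mC: "m \<in> C" using m by (auto simp: D_def)
      have zm: "z m \<le> y m" "y m - g/4 < z m" using upper[OF z(1) m(2)] z(2)[OF mC] m by auto
      have "self_certified C R A Sp ?z"
        unfolding self_certified_def
      proof (intro ballI conjI impI)
        fix a assume a: "a \<in> C"
        then show "0 \<le> ?z a" using z0 g by (auto simp: add_nonneg_nonneg)
        assume pos: "0 < ?z a"
        show "\<exists>r\<in>R. a \<in> Sp r \<and> (\<forall>m'\<in>Sp r - {a}. A r a + ?z a < A r m' + ?z m')"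
        proof (cases "a = m")
          case True
          have "A r m + ?z m < A r m' + ?z m'" if "m' \<in> Sp r - {m}" for m'
            using z(2)[of m'] g(2)[of m'] g(1) Sp[OF r] that zm by (auto split: if_splits)
          then show ?thesis using r m True by blast
        next
          case False
          then obtain r' where "r' \<in> R" "a \<in> Sp r'" "\<forall>m'\<in>Sp r' - {a}. A r' a + z a < A r' m' + z m'"
            using z(1) a pos by (auto simp: self_certified_def)
          moreover have "A r' a + ?z a < A r' m' + ?z m'"
            if "A r' a + z a < A r' m' + z m'" for m' using that False g(1) by auto
          ultimately show ?thesis by blast
        qed
      qed
      from upper[OF this m(2)] show False using zm g by auto
    qed
  next
    fix m assume m: "m \<in> C - D"
    then have "0 < u m" using u(2) b0 by force
    then obtain r where r: "r \<in> R" "m \<in> Sp r" "\<And>m'. m' \<in> Sp r - {m} \<Longrightarrow> A r m + u m < A r m' + u m'"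
      using u(1) m unfolding self_certified_def by blast
    have "m' \<notin> D" if m': "m' \<in> Sp r" for m'
    proof
      assume D: "m' \<in> D"
      have "A r m' + y m' - A r m \<le> b"
        unfolding b_def using finbs r Sp[of r] D m' m unfolding bs_def by (intro Max_ge) force+
      moreover have "u m' \<le> y m'" using upper[OF u(1) D] .
      moreover have "b < u m" using u(2) m by force
      ultimately show False using r(3)[of m'] m' m D by auto
    qed
    then show "\<exists>r\<in>R. m \<in> Sp r \<and> Sp r \<subseteq> C - D \<and> (\<forall>m'\<in>Sp r - {m}. A r m + u m < A r m' + u m')"
      using r Sp by blast
  qed
qed

section \<open>Motzkin's transposition theorem\<close>

text \<open>
  A triple of coefficients \<open>\<alpha>\<close>, constant \<open>\<beta>\<close> and flag \<open>s\<close> stands for \<open>0 \<le> \<beta> + \<alpha> \<bullet> a\<close>, with a strict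
  inequality if the flag is set.
\<close>

type_synonym 'v constraint = "('v \<Rightarrow> real) \<times> real \<times> bool"

definition satisfies :: "'v set \<Rightarrow> ('v \<Rightarrow> real) \<Rightarrow> 'v constraint \<Rightarrow> bool" where
  "satisfies V a q = (case q of (\<alpha>, \<beta>, s) \<Rightarrow>
     0 \<le> \<beta> + (\<Sum>v\<in>V. \<alpha> v * a v) \<and> (s \<longrightarrow> 0 < \<beta> + (\<Sum>v\<in>V. \<alpha> v * a v)))"

inductive_set constraint_cone :: "'v constraint set \<Rightarrow> 'v constraint set" for Q where
  base: "q \<in> Q \<Longrightarrow> q \<in> constraint_cone Q"
| combine: "(\<alpha>, \<beta>, s) \<in> constraint_cone Q \<Longrightarrow> (\<alpha>', \<beta>', s') \<in> constraint_cone Q \<Longrightarrow> 0 < r \<Longrightarrow> 0 < r' \<Longrightarrow>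
    (\<lambda>v. r * \<alpha> v + r' * \<alpha>' v, r * \<beta> + r' * \<beta>', s \<or> s') \<in> constraint_cone Q"

lemma constraint_cone_minimal:
  assumes "Q' \<subseteq> constraint_cone Q" "q \<in> constraint_cone Q'"
  shows "q \<in> constraint_cone Q"
  using assms(2) by induction (use assms(1) in \<open>auto intro: constraint_cone.combine\<close>)

lemma constraint_cone_coordinate_zero:
  assumes "\<And>q. q \<in> Q \<Longrightarrow> fst q v = 0" "q \<in> constraint_cone Q"
  shows "fst q v = 0"
  using assms(2) by induction (use assms(1) in auto)

lemma point_between:
  fixes L U :: "'q \<Rightarrow> real"
  assumes "finite P" "finite N"
    and "\<And>p q. p \<in> P \<Longrightarrow> q \<in> N \<Longrightarrow> L p \<le> U q \<and> (s p \<or> s q \<longrightarrow> L p < U q)"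
  obtains r where "\<And>p. p \<in> P \<Longrightarrow> L p \<le> r \<and> (s p \<longrightarrow> L p < r)"
    "\<And>q. q \<in> N \<Longrightarrow> r \<le> U q \<and> (s q \<longrightarrow> r < U q)"
proof -
  have "bdd_above (L ` P)" "bdd_below (U ` N)" using assms(1,2) by simp_all
  then have up: "\<exists>M. \<forall>p\<in>P. L p < M" and dn: "\<exists>M. \<forall>q\<in>N. M < U q"
    unfolding bdd_above_def bdd_below_def by (meson gt_ex imageI le_less_trans lt_ex less_le_trans)+
  consider "P = {}" | "N = {}" | "P \<noteq> {}" "N \<noteq> {}" by blast
  then show ?thesis
  proof cases
    case 1
    from dn obtain M where "\<And>q. q \<in> N \<Longrightarrow> M < U q" by blast
    with 1 that[of M] show ?thesis by (simp add: less_imp_le)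
  next
    case 2
    from up obtain M where "\<And>p. p \<in> P \<Longrightarrow> L p < M" by blast
    with 2 that[of M] show ?thesis by (simp add: less_imp_le)
  next
    case 3
    have "Max (L ` P) \<in> L ` P" "Min (U ` N) \<in> U ` N"
      using 3 assms(1,2) by (auto intro!: Max_in Min_in)
    then obtain p0 q0 where "p0 \<in> P" "Max (L ` P) = L p0" "q0 \<in> N" "Min (U ` N) = U q0" by blast
    then have p0: "p0 \<in> P" "\<And>p. p \<in> P \<Longrightarrow> L p \<le> L p0" and q0: "q0 \<in> N" "\<And>q. q \<in> N \<Longrightarrow> U q0 \<le> U q"
      using assms(1,2) Max_ge[of "L ` P"] Min_le[of "U ` N"] by auto
    show ?thesis
    proof (rule that[of "(L p0 + U q0) / 2"])
      show "L p \<le> (L p0 + U q0) / 2 \<and> (s p \<longrightarrow> L p < (L p0 + U q0) / 2)" if "p \<in> P" for p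
        using p0 q0 assms(3)[OF p0(1) q0(1)] assms(3)[OF that q0(1)] p0(2)[OF that] by auto
      show "(L p0 + U q0) / 2 \<le> U q \<and> (s q \<longrightarrow> (L p0 + U q0) / 2 < U q)" if "q \<in> N" for q
        using p0 q0 assms(3)[OF p0(1) q0(1)] assms(3)[OF p0(1) that] q0(2)[OF that] by auto
    qed
  qed
qed

text \<open>
  Fourier--Motzkin elimination: the constraints in which a variable \<open>v\<close> is bounded from below and those
  in which it is bounded from above are combined in pairs so that \<open>v\<close> cancels. A solution of the
  combined system leaves room for a value of \<open>v\<close>, by \<open>point_between\<close>; a contradiction in the combined
  system lies in the cone of the original one.
\<close>

theorem motzkin_transposition:
  assumes "finite V" "finite Q"
  shows "(\<exists>a. \<forall>q\<in>Q. satisfies V a q) \<or>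
    (\<exists>\<alpha> \<beta> s. (\<alpha>, \<beta>, s) \<in> constraint_cone Q \<and> (\<forall>v\<in>V. \<alpha> v = 0) \<and> \<beta> \<le> 0 \<and> (s \<or> \<beta> < 0))"
  using assms
proof (induction V arbitrary: Q)
  case empty
  show ?case
  proof (cases "\<forall>q\<in>Q. satisfies {} (\<lambda>_. 0) q")
    case False
    then obtain \<alpha> \<beta> s where "(\<alpha>, \<beta>, s) \<in> Q" "\<not> satisfies {} (\<lambda>_. 0) (\<alpha>, \<beta>, s)" by (metis prod_cases3)
    then show ?thesis by (intro disjI2 exI[of _ \<alpha>] exI[of _ \<beta>] exI[of _ s])
        (auto simp: satisfies_def constraint_cone.base)
  qed blast
next
  case (insert v V)
  define P where "P = {q\<in>Q. 0 < fst q v}"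
  define N where "N = {q\<in>Q. fst q v < 0}"
  define comb :: "'a constraint \<times> 'a constraint \<Rightarrow> 'a constraint" where
    "comb = (\<lambda>((\<alpha>, \<beta>, s), (\<alpha>', \<beta>', s')).
       (\<lambda>w. - \<alpha>' v * \<alpha> w + \<alpha> v * \<alpha>' w, - \<alpha>' v * \<beta> + \<alpha> v * \<beta>', s \<or> s'))"
  define Q' where "Q' = {q\<in>Q. fst q v = 0} \<union> comb ` (P \<times> N)"
  have fin: "finite P" "finite N" "finite Q'" using insert.prems by (auto simp: P_def N_def Q'_def)
  have sub: "Q' \<subseteq> constraint_cone Q"
  proof
    fix q assume "q \<in> Q'"
    then consider "q \<in> Q" | p p' where "q = comb (p, p')" "p \<in> P" "p' \<in> N" by (auto simp: Q'_def)
    then show "q \<in> constraint_cone Q"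
    proof cases
      case 2
      obtain \<alpha> \<beta> s \<alpha>' \<beta>' s' where pq: "p = (\<alpha>, \<beta>, s)" "p' = (\<alpha>', \<beta>', s')" by (metis prod_cases3)
      have "p \<in> constraint_cone Q" "p' \<in> constraint_cone Q" "0 < - \<alpha>' v" "0 < \<alpha> v"
        using 2 by (auto simp: P_def N_def pq intro: constraint_cone.base)
      from constraint_cone.combine[OF this[unfolded pq]] show ?thesis by (simp add: 2(1) comb_def pq)
    qed (rule constraint_cone.base)
  qed
  have zero: "fst q v = 0" if "q \<in> Q'" for q
    using that by (auto simp: Q'_def comb_def)
  from insert.IH[OF fin(3)] show ?case
  proof
    assume "\<exists>a. \<forall>q\<in>Q'. satisfies V a q"
    then obtain a where a: "\<And>q. q \<in> Q' \<Longrightarrow> satisfies V a q" by blast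
    define rest where "rest q = fst (snd q) + (\<Sum>w\<in>V. fst q w * a w)" for q :: "'a constraint"
    have "- rest p / fst p v \<le> - rest q / fst q v \<and>
          (snd (snd p) \<or> snd (snd q) \<longrightarrow> - rest p / fst p v < - rest q / fst q v)"
      if "p \<in> P" "q \<in> N" for p q
    proof -
      obtain \<alpha> \<beta> s \<alpha>' \<beta>' s' where pq: "p = (\<alpha>, \<beta>, s)" "q = (\<alpha>', \<beta>', s')" by (metis prod_cases3)
      have "satisfies V a (comb (p, q))" using a that by (auto simp: Q'_def)
      moreover have "- \<alpha>' v * \<beta> + \<alpha> v * \<beta>' + (\<Sum>w\<in>V. (- \<alpha>' v * \<alpha> w + \<alpha> v * \<alpha>' w) * a w)
          = - \<alpha>' v * rest p + \<alpha> v * rest q"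
        by (simp add: rest_def pq algebra_simps sum.distrib sum_distrib_left sum_subtractf sum_negf)
      ultimately have "0 \<le> - \<alpha>' v * rest p + \<alpha> v * rest q"
        "s \<or> s' \<Longrightarrow> 0 < - \<alpha>' v * rest p + \<alpha> v * rest q"
        unfolding satisfies_def comb_def pq by simp_all
      moreover have "\<alpha> v > 0" "\<alpha>' v < 0" using that by (auto simp: P_def N_def pq)
      ultimately show ?thesis by (auto simp: pq field_simps)
    qed
    from point_between[where L = "\<lambda>p. - rest p / fst p v" and U = "\<lambda>q. - rest q / fst q v" and s = "\<lambda>q. snd (snd q)", OF fin(1,2) this]
    obtain r where
      r: "\<And>p. p \<in> P \<Longrightarrow> - rest p / fst p v \<le> r \<and> (snd (snd p) \<longrightarrow> - rest p / fst p v < r)"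
         "\<And>q. q \<in> N \<Longrightarrow> r \<le> - rest q / fst q v \<and> (snd (snd q) \<longrightarrow> r < - rest q / fst q v)"
      by blast
    have "satisfies (insert v V) (a(v := r)) q" if q: "q \<in> Q" for q
    proof -
      obtain \<alpha> \<beta> s where qq: "q = (\<alpha>, \<beta>, s)" by (metis prod_cases3)
      have "(\<Sum>w\<in>V. \<alpha> w * (a(v := r)) w) = (\<Sum>w\<in>V. \<alpha> w * a w)"
        using insert.hyps by (intro sum.cong) auto
      then have val: "\<beta> + (\<Sum>w\<in>insert v V. \<alpha> w * (a(v := r)) w) = rest q + \<alpha> v * r"
        using insert.hyps by (simp add: rest_def qq)
      consider "\<alpha> v = 0" | "\<alpha> v > 0" | "\<alpha> v < 0" by linarith
      then have "0 \<le> rest q + \<alpha> v * r \<and> (s \<longrightarrow> 0 < rest q + \<alpha> v * r)"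
      proof cases
        case 1
        then have "satisfies V a q" using a q by (auto simp: Q'_def qq)
        then show ?thesis using 1 by (simp add: satisfies_def qq rest_def)
      next
        case 2
        then have "q \<in> P" using q by (auto simp: P_def qq)
        with r(1)[OF this] 2 show ?thesis by (auto simp: qq field_simps)
      next
        case 3
        then have "q \<in> N" using q by (auto simp: N_def qq)
        with r(2)[OF this] 3 show ?thesis by (auto simp: qq field_simps)
      qed
      then show ?thesis unfolding satisfies_def qq using val by (simp add: qq)
    qed
    then show ?thesis by blast
  next
    assume "\<exists>\<alpha> \<beta> s. (\<alpha>, \<beta>, s) \<in> constraint_cone Q' \<and> (\<forall>v\<in>V. \<alpha> v = 0) \<and> \<beta> \<le> 0 \<and> (s \<or> \<beta> < 0)"
    then obtain \<alpha> \<beta> s where c: "(\<alpha>, \<beta>, s) \<in> constraint_cone Q'" "\<forall>v\<in>V. \<alpha> v = 0" "\<beta> \<le> 0" "s \<or> \<beta> < 0" by blast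
    have "\<alpha> v = 0" using constraint_cone_coordinate_zero[of Q' v, OF zero c(1)] by simp
    then show ?thesis using c constraint_cone_minimal[OF sub c(1)] by blast
  qed
qed

section \<open>Mixtures of monomials\<close>

text \<open>
  The point \<open>J\<close> lies in \<open>E + 2 \<cdot> (P\<^sub>1 + \<dots> + P\<^sub>k)\<close>, where \<open>P\<^sub>i\<close> is the convex hull of \<open>S i\<close>, and \<open>\<mu>\<close>
  records the weights of one way to write it so. The factor exceeds \<open>1\<close> so that a vertex of \<open>P\<^sub>i\<close> that
  carries all the weight keeps some of it when one unit is moved away.
\<close>

definition doubled_mixture ::
  "nat \<Rightarrow> 'i set \<Rightarrow> ('i \<Rightarrow> expo set) \<Rightarrow> expo \<Rightarrow> ('i \<times> expo \<Rightarrow> real) \<Rightarrow> expo \<Rightarrow> bool" where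
  "doubled_mixture n K S E \<mu> J \<longleftrightarrow>
     (\<forall>x. 0 \<le> \<mu> x \<and> (x \<notin> Sigma K S \<longrightarrow> \<mu> x = 0)) \<and>
     (\<forall>i\<in>K. (\<Sum>I\<in>S i. \<mu> (i, I)) = 2) \<and>
     (\<forall>w<n. real (J w) = real (E w) + (\<Sum>x\<in>Sigma K S. \<mu> x * real (snd x w)))"

lemma sum_pairs:
  fixes f :: "'i \<times> expo \<Rightarrow> real"
  assumes "finite K" "\<And>i. i \<in> K \<Longrightarrow> finite (S i)"
  shows "(\<Sum>x\<in>Sigma K S. f x) = (\<Sum>i\<in>K. \<Sum>I\<in>S i. f (i, I))"
proof -
  have "(\<Sum>i\<in>K. \<Sum>I\<in>S i. f (i, I)) = (\<Sum>(i, I)\<in>Sigma K S. f (i, I))"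
    using assms by (intro sum.Sigma) auto
  then show ?thesis by simp
qed

lemma sum_fibre:
  fixes f :: "'i \<times> expo \<Rightarrow> real"
  assumes "finite K" "\<And>i. i \<in> K \<Longrightarrow> finite (S i)" "j \<in> K"
  shows "(\<Sum>I\<in>S j. f (j, I)) = (\<Sum>x\<in>Sigma K S. f x * of_bool (fst x = j))"
proof -
  have "(\<Sum>x\<in>Sigma K S. f x * of_bool (fst x = j)) = (\<Sum>i\<in>K. if i = j then \<Sum>I\<in>S i. f (i, I) else 0)"
    by (subst sum_pairs[OF assms(1,2)]) (auto intro!: sum.cong)
  also have "\<dots> = (\<Sum>I\<in>S j. f (j, I))" using assms(1,3) by (simp add: sum.delta')
  finally show ?thesis by simp
qed

lemma doubled_mixture_le_2:
  assumes fin: "finite K" "\<And>i. i \<in> K \<Longrightarrow> finite (S i)"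
    and "doubled_mixture n K S E \<mu> J" "x \<in> Sigma K S"
  shows "\<mu> x \<le> 2"
proof -
  obtain i I where x: "x = (i, I)" "i \<in> K" "I \<in> S i" using assms(4) by auto
  have "\<mu> (i, I) \<le> (\<Sum>I\<in>S i. \<mu> (i, I))"
    using assms(3) x fin by (intro member_le_sum) (auto simp: doubled_mixture_def)
  then show ?thesis using assms(3) x by (simp add: doubled_mixture_def)
qed

text \<open>
  For a fixed point the mixtures form a compact polytope in the product topology.
\<close>

lemma cheapest_mixture_exists:
  fixes c :: "'i \<times> expo \<Rightarrow> real"
  assumes fin: "finite K" "\<And>i. i \<in> K \<Longrightarrow> finite (S i)"
    and "doubled_mixture n K S E \<mu>0 J"
  obtains \<mu> where "doubled_mixture n K S E \<mu> J"
    "\<And>\<mu>'. doubled_mixture n K S E \<mu>' J \<Longrightarrow>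
       (\<Sum>x\<in>Sigma K S. \<mu> x * c x) \<le> (\<Sum>x\<in>Sigma K S. \<mu>' x * c x)"
proof -
  let ?X = "Sigma K S"
  let ?W = "{\<mu>. doubled_mixture n K S E \<mu> J}"
  let ?B = "PiE UNIV (\<lambda>x. if x \<in> ?X then {0..2} else {0 :: real})"
  have coord: "continuous_on UNIV (\<lambda>\<mu> :: 'i \<times> expo \<Rightarrow> real. \<mu> x)" for x
    by (rule continuous_on_product_coordinates)
  have "compactin (product_topology (\<lambda>_. euclidean) UNIV) ?B"
    by (subst compactin_PiE) auto
  then have "compact ?B" by (simp add: euclidean_product_topology)
  moreover have "closed ?W"
    unfolding doubled_mixture_def Ball_def
    by (intro closed_Collect_conj closed_Collect_all closed_Collect_imp closed_Collect_eq closed_Collect_le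
          continuous_intros coord open_Collect_const)
  moreover have "?W \<subseteq> ?B"
    using doubled_mixture_le_2[OF fin] by (auto simp: doubled_mixture_def)
  ultimately have "compact ?W" by (metis compact_Int_closed inf.absorb2)
  moreover have "continuous_on ?W (\<lambda>\<mu>. \<Sum>x\<in>?X. \<mu> x * c x)"
    by (intro continuous_intros continuous_on_subset[OF coord]) auto
  ultimately show ?thesis using continuous_attains_inf[of ?W] assms(3) that by blast
qed

lemma positive_perturbation:
  fixes \<mu> \<nu> :: "'x \<Rightarrow> real"
  assumes "finite Z" "\<And>x. x \<in> Z \<Longrightarrow> 0 < \<mu> x"
  shows "\<exists>\<epsilon>>0. \<forall>x\<in>Z. 0 < \<mu> x + \<epsilon> * \<nu> x"
proof -
  have "\<forall>\<^sub>F \<epsilon> in at_right 0. 0 < \<mu> x + \<epsilon> * \<nu> x" if "x \<in> Z" for x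
  proof -
    have "((\<lambda>\<epsilon>. \<mu> x + \<epsilon> * \<nu> x) \<longlongrightarrow> \<mu> x + 0 * \<nu> x) (at_right 0)" by (intro tendsto_intros)
    then show ?thesis using assms(2)[OF that] by (intro order_tendstoD(1)) auto
  qed
  then have "\<forall>\<^sub>F \<epsilon> in at_right 0. \<forall>x\<in>Z. 0 < \<mu> x + \<epsilon> * \<nu> x"
    using assms(1) by (simp add: eventually_ball_finite)
  then have "\<forall>\<^sub>F \<epsilon> in at_right 0. (\<forall>x\<in>Z. 0 < \<mu> x + \<epsilon> * \<nu> x) \<and> 0 < \<epsilon>"
    by (intro eventually_conj eventually_at_right_less)
  from eventually_happens'[OF _ this] show ?thesis by auto
qed

text \<open>
  The form in which linear programming duality is used: either for some slope \<open>a\<close>, in every block that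
  meets \<open>Z\<close>, the minimum of \<open>c + a \<bullet> I\<close> is attained exactly at the members of \<open>Z\<close> (\<open>t i\<close> is the minimum
  of block \<open>i\<close>), or the weights can be moved in a direction \<open>\<nu>\<close> that keeps the point and the block sums,
  does not increase the cost, and lowers the cost or enlarges the support \<open>Z\<close>. Equations are encoded as
  pairs of inequalities.
\<close>

lemma strict_complementarity:
  fixes c :: "'i \<times> expo \<Rightarrow> real" and X :: "('i \<times> expo) set"
  assumes fin: "finite K" "finite X" "fst ` X \<subseteq> K" and "Z \<subseteq> X"
  obtains a :: "nat \<Rightarrow> real" and t :: "'i \<Rightarrow> real" where
    "\<And>x. x \<in> Z \<Longrightarrow> c x + (\<Sum>w<n. a w * real (snd x w)) = t (fst x)"
    "\<And>x. x \<in> X - Z \<Longrightarrow> t (fst x) < c x + (\<Sum>w<n. a w * real (snd x w))"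
  | \<nu> :: "'i \<times> expo \<Rightarrow> real" where
    "\<And>x. x \<in> X - Z \<Longrightarrow> 0 \<le> \<nu> x"
    "\<And>w. w < n \<Longrightarrow> (\<Sum>x\<in>X. \<nu> x * real (snd x w)) = 0"
    "\<And>i. i \<in> K \<Longrightarrow> (\<Sum>x\<in>X. \<nu> x * of_bool (fst x = i)) = 0"
    "(\<Sum>x\<in>X. \<nu> x * c x) \<le> 0" "(\<Sum>x\<in>X. \<nu> x * c x) < 0 \<or> (\<exists>x\<in>X - Z. 0 < \<nu> x)"
proof -
  define V where "V = Inl ` {..<n} \<union> Inr ` K"
  define row :: "'i \<times> expo \<Rightarrow> nat + 'i \<Rightarrow> real" where
    "row x s = (case s of Inl w \<Rightarrow> real (snd x w) | Inr i \<Rightarrow> - of_bool (fst x = i))" for x s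
  define Q where "Q = (\<lambda>x. (row x, c x, True)) ` (X - Z) \<union> (\<lambda>x. (row x, c x, False)) ` Z
    \<union> (\<lambda>x. (\<lambda>s. - row x s, - c x, False)) ` Z"
  have finV: "finite V" "finite Q" using fin(1,2) \<open>Z \<subseteq> X\<close> finite_subset[of Z X] by (auto simp: V_def Q_def)
  from motzkin_transposition[OF this] consider a where "\<forall>q\<in>Q. satisfies V a q"
    | \<alpha> \<beta> s where "(\<alpha>, \<beta>, s) \<in> constraint_cone Q" "\<forall>v\<in>V. \<alpha> v = 0" "\<beta> \<le> 0" "s \<or> \<beta> < 0"
    by blast
  then show ?thesis
  proof cases
    case a: (1 a)
    have val: "(\<Sum>s\<in>V. row x s * a s) = (\<Sum>w<n. a (Inl w) * real (snd x w)) - a (Inr (fst x))"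
      if "x \<in> X" for x
    proof -
      have "(\<Sum>s\<in>V. row x s * a s) = (\<Sum>s\<in>Inl ` {..<n}. row x s * a s) + (\<Sum>s\<in>Inr ` K. row x s * a s)"
        unfolding V_def using fin by (intro sum.union_disjoint) auto
      also have "(\<Sum>s\<in>Inr ` K. row x s * a s) = (\<Sum>i\<in>K. if i = fst x then - a (Inr i) else 0)"
        by (subst sum.reindex) (auto simp: row_def intro!: sum.cong)
      also have "\<dots> = - a (Inr (fst x))" using fin that by (auto simp: sum.delta)
      also have "(\<Sum>s\<in>Inl ` {..<n}. row x s * a s) = (\<Sum>w<n. a (Inl w) * real (snd x w))"
        by (subst sum.reindex) (auto simp: row_def mult.commute intro!: sum.cong)
      finally show ?thesis by simp
    qed
    show ?thesis
    proof (rule that(1)[of "\<lambda>w. a (Inl w)" "\<lambda>i. a (Inr i)"])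
      fix x assume "x \<in> Z"
      then have "satisfies V a (row x, c x, False)" "satisfies V a (\<lambda>s. - row x s, - c x, False)" "x \<in> X"
        using a \<open>Z \<subseteq> X\<close> by (auto simp: Q_def)
      then show "c x + (\<Sum>w<n. a (Inl w) * real (snd x w)) = a (Inr (fst x))"
        by (simp add: satisfies_def val sum_negf)
    next
      fix x assume "x \<in> X - Z"
      then have "satisfies V a (row x, c x, True)" "x \<in> X" using a by (auto simp: Q_def)
      then show "a (Inr (fst x)) < c x + (\<Sum>w<n. a (Inl w) * real (snd x w))"
        by (simp add: satisfies_def val)
    qed
  next
    case cert: (2 \<alpha> \<beta> s)
    have "\<exists>\<nu>. (\<forall>x\<in>X - Z. 0 \<le> \<nu> x) \<and> (\<forall>v. fst q v = (\<Sum>x\<in>X. \<nu> x * row x v)) \<and>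
        fst (snd q) = (\<Sum>x\<in>X. \<nu> x * c x) \<and> (snd (snd q) \<longrightarrow> (\<exists>x\<in>X - Z. 0 < \<nu> x))"
      if "q \<in> constraint_cone Q" for q
      using that
    proof induction
      case (base q)
      then consider x where "x \<in> X - Z" "q = (row x, c x, True)" | x where "x \<in> Z" "q = (row x, c x, False)"
        | x where "x \<in> Z" "q = (\<lambda>s. - row x s, - c x, False)" by (auto simp: Q_def)
      then show ?case
      proof cases
        case 1 then show ?thesis using fin
          by (intro exI[of _ "\<lambda>y. of_bool (y = x)"]) (auto simp: of_bool_def if_distrib[of "\<lambda>t. t * _"] if_distrib[of uminus] sum.delta cong: if_cong)
      next
        case 2 then show ?thesis using fin \<open>Z \<subseteq> X\<close>
          by (intro exI[of _ "\<lambda>y. of_bool (y = x)"]) (auto simp: of_bool_def if_distrib[of "\<lambda>t. t * _"] if_distrib[of uminus] sum.delta cong: if_cong)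
      next
        case 3 then show ?thesis using fin \<open>Z \<subseteq> X\<close>
          by (intro exI[of _ "\<lambda>y. - of_bool (y = x)"]) (auto simp: of_bool_def if_distrib[of "\<lambda>t. t * _"] if_distrib[of uminus] sum.delta cong: if_cong)
      qed
    next
      case (combine \<alpha> \<beta> s \<alpha>' \<beta>' s' r r')
      then obtain \<nu> \<nu>' where
        1: "\<forall>x\<in>X - Z. 0 \<le> \<nu> x" "\<And>v. \<alpha> v = (\<Sum>x\<in>X. \<nu> x * row x v)" "\<beta> = (\<Sum>x\<in>X. \<nu> x * c x)"
           "s \<longrightarrow> (\<exists>x\<in>X - Z. 0 < \<nu> x)" and
        2: "\<forall>x\<in>X - Z. 0 \<le> \<nu>' x" "\<And>v. \<alpha>' v = (\<Sum>x\<in>X. \<nu>' x * row x v)" "\<beta>' = (\<Sum>x\<in>X. \<nu>' x * c x)"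
           "s' \<longrightarrow> (\<exists>x\<in>X - Z. 0 < \<nu>' x)"
        by auto
      show ?case
      proof (intro exI[of _ "\<lambda>x. r * \<nu> x + r' * \<nu>' x"] conjI)
        show "\<forall>x\<in>X - Z. 0 \<le> r * \<nu> x + r' * \<nu>' x" using 1(1) 2(1) combine by auto
        show "snd (snd (\<lambda>v. r * \<alpha> v + r' * \<alpha>' v, r * \<beta> + r' * \<beta>', s \<or> s')) \<longrightarrow>
            (\<exists>x\<in>X - Z. 0 < r * \<nu> x + r' * \<nu>' x)"
        proof
          assume "snd (snd (\<lambda>v. r * \<alpha> v + r' * \<alpha>' v, r * \<beta> + r' * \<beta>', s \<or> s'))"
          then obtain x where "x \<in> X - Z" "0 < \<nu> x \<or> 0 < \<nu>' x" using 1(4) 2(4) by auto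
          then show "\<exists>x\<in>X - Z. 0 < r * \<nu> x + r' * \<nu>' x"
            using 1(1) 2(1) combine(3,4) by (intro bexI[of _ x]) (auto simp: add_pos_nonneg add_nonneg_pos)
        qed
      qed (simp_all add: 1(2,3) 2(2,3) sum_distrib_left algebra_simps sum.distrib)
    qed
    from this[OF cert(1)] obtain \<nu> where \<nu>: "\<forall>x\<in>X - Z. 0 \<le> \<nu> x" "\<forall>v. \<alpha> v = (\<Sum>x\<in>X. \<nu> x * row x v)"
      "\<beta> = (\<Sum>x\<in>X. \<nu> x * c x)" "s \<longrightarrow> (\<exists>x\<in>X - Z. 0 < \<nu> x)" by auto
    show ?thesis
    proof (rule that(2)[of \<nu>])
      show "(\<Sum>x\<in>X. \<nu> x * real (snd x w)) = 0" if "w < n" for w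
        using cert(2) \<nu>(2) that by (force simp: V_def row_def)
      show "(\<Sum>x\<in>X. \<nu> x * of_bool (fst x = i)) = 0" if "i \<in> K" for i
      proof -
        have "0 = (\<Sum>x\<in>X. \<nu> x * row x (Inr i))" using cert(2) \<nu>(2) that by (auto simp: V_def)
        then show ?thesis by (simp add: row_def sum_negf)
      qed
      show "0 \<le> \<nu> x" if "x \<in> X - Z" for x using \<nu>(1) that by blast
      show "(\<Sum>x\<in>X. \<nu> x * c x) \<le> 0" "(\<Sum>x\<in>X. \<nu> x * c x) < 0 \<or> (\<exists>x\<in>X - Z. 0 < \<nu> x)"
        using cert(3,4) \<nu>(3,4) by blast+
    qed
  qed
qed

section \<open>The touching argument\<close>

lemma doubled_mixture_weight_le:
  assumes fin: "finite K" "\<And>i. i \<in> K \<Longrightarrow> finite (S i)"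
    and mix: "doubled_mixture n K S E \<mu> J"
    and i: "i \<in> K" "v \<in> S i" and one: "1 \<le> \<mu> (i, v)" and w: "w < n"
  shows "v w \<le> J w"
proof -
  have "real (J w) = real (E w) + (\<Sum>x\<in>Sigma K S. \<mu> x * real (snd x w))"
    using mix w by (simp add: doubled_mixture_def)
  moreover have "\<mu> (i, v) * real (snd (i, v) w) \<le> (\<Sum>x\<in>Sigma K S. \<mu> x * real (snd x w))"
    using mix i fin by (intro member_le_sum) (auto simp: doubled_mixture_def)
  moreover have "1 * real (v w) \<le> \<mu> (i, v) * real (v w)" using one by (intro mult_right_mono) auto
  ultimately show ?thesis by simp
qed

text \<open>
  Moving one unit of weight from \<open>v\<close> to \<open>I\<close> in block \<open>i\<close> moves the mixed point by \<open>I - v\<close>.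
\<close>

lemma doubled_mixture_exchange:
  assumes fin: "finite K" "\<And>i. i \<in> K \<Longrightarrow> finite (S i)"
    and mix: "doubled_mixture n K S E \<mu> J"
    and i: "i \<in> K" "v \<in> S i" "I \<in> S i" "I \<noteq> v" and one: "1 \<le> \<mu> (i, v)"
  defines "\<mu>' \<equiv> (\<lambda>x. \<mu> x + of_bool (x = (i, I)) - of_bool (x = (i, v)))"
  shows "doubled_mixture n K S E \<mu>' (\<lambda>w. J w - v w + I w)" (is ?mix)
    and "(\<Sum>x\<in>Sigma K S. \<mu>' x * c x) = (\<Sum>x\<in>Sigma K S. \<mu> x * c x) + c (i, I) - (c (i, v) :: real)"
proof -
  let ?X = "Sigma K S"
  have finX: "finite ?X" using fin by simp
  have fibre: "(\<Sum>I\<in>S j. f (j, I)) = (\<Sum>x\<in>?X. f x * of_bool (fst x = j))"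
    if "j \<in> K" for j and f :: "_ \<Rightarrow> real"
    by (intro sum_fibre fin that)
  show sum_eq: "(\<Sum>x\<in>?X. \<mu>' x * c x) = (\<Sum>x\<in>?X. \<mu> x * c x) + c (i, I) - c (i, v)" for c :: "_ \<Rightarrow> real"
  proof -
    have "(\<Sum>x\<in>?X. \<mu>' x * c x) = (\<Sum>x\<in>?X. \<mu> x * c x + (if x = (i, I) then c x else 0) - (if x = (i, v) then c x else 0))"
      by (intro sum.cong) (auto simp: \<mu>'_def algebra_simps)
    also have "\<dots> = (\<Sum>x\<in>?X. \<mu> x * c x) + c (i, I) - c (i, v)"
      using finX i by (simp add: sum.distrib sum_subtractf sum.delta)
    finally show ?thesis .
  qed
  have le: "\<forall>w<n. v w \<le> J w" using doubled_mixture_weight_le[OF fin mix i(1,2) one] by blast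
  show ?mix
    unfolding doubled_mixture_def
  proof (intro conjI allI impI ballI)
    show "0 \<le> \<mu>' x" for x
    proof -
      have "0 \<le> \<mu> x" using mix by (cases x) (simp add: doubled_mixture_def)
      then show ?thesis using one by (auto simp: \<mu>'_def)
    qed
    show "\<mu>' x = 0" if "x \<notin> ?X" for x using mix i that by (cases x) (auto simp: \<mu>'_def doubled_mixture_def)
    show "(\<Sum>I\<in>S j. \<mu>' (j, I)) = 2" if "j \<in> K" for j
    proof -
      have "(\<Sum>x\<in>?X. \<mu>' x * of_bool (fst x = j)) = (\<Sum>x\<in>?X. \<mu> x * of_bool (fst x = j))"
        by (subst sum_eq) simp
      then show ?thesis
        using fibre[OF that, of \<mu>'] fibre[OF that, of \<mu>] mix that
        by (simp add: doubled_mixture_def)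
    qed
    show "real (J w - v w + I w) = real (E w) + (\<Sum>x\<in>?X. \<mu>' x * real (snd x w))" if "w < n" for w
    proof -
      have "v w \<le> J w" using le that by blast
      then have "real (J w - v w + I w) = real (J w) - real (v w) + real (I w)" by (simp add: of_nat_diff)
      then show ?thesis using mix that by (subst sum_eq) (simp add: doubled_mixture_def)
    qed
  qed
qed

text \<open>
  The touching argument. Push the graph of the concave envelope of \<open>- c\<close>, dilated by \<open>2\<close> and translated
  by \<open>E\<close>, up against the graph of \<open>y\<close>: this amounts to minimising \<open>y J + \<Sum> \<mu> c\<close> over \<open>J \<in> A\<close> and all
  mixtures of \<open>J\<close>. Among the minimisers choose one with \<open>\<mu>\<close> of largest support. By strict complementarity
  some slope \<open>a\<close> has exactly this support as its minimising monomials. As \<open>a\<close> is not a root, some block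
  \<open>i\<close> has a single minimising monomial \<open>v\<close>, which therefore carries the whole weight \<open>2\<close>. Exchanging one
  unit of it for another monomial \<open>I\<close> gives a competitor of larger support, hence of strictly larger
  cost, unless its point lies outside \<open>A\<close>. So row \<open>J - v\<close> of polynomial \<open>i\<close> has its only minimum at
  \<open>v\<close>, as far as the monomials \<open>S i\<close> are concerned.
\<close>

theorem touching_mixture:
  fixes c :: "'i \<Rightarrow> expo \<Rightarrow> real" and y :: "expo \<Rightarrow> real"
  assumes fin: "finite K" "\<And>i. i \<in> K \<Longrightarrow> finite (S i)" and "finite A"
    and no_root: "\<And>a :: nat \<Rightarrow> real. \<exists>i\<in>K. \<exists>v\<in>S i. \<forall>I\<in>S i - {v}.
      c i v + (\<Sum>w<n. a w * real (v w)) < c i I + (\<Sum>w<n. a w * real (I w))"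
    and start: "J0 \<in> A" "doubled_mixture n K S E \<mu>0 J0"
  obtains i v J \<mu> where "i \<in> K" "v \<in> S i" "J \<in> A" "doubled_mixture n K S E \<mu> J" "\<mu> (i, v) = 2"
    "\<forall>w<n. v w \<le> J w"
    "\<And>I. I \<in> S i \<Longrightarrow> I \<noteq> v \<Longrightarrow> (\<lambda>w. J w - v w + I w) \<in> A \<Longrightarrow>
       c i v + y J < c i I + y (\<lambda>w. J w - v w + I w)"
proof -
  let ?X = "Sigma K S"
  let ?c = "\<lambda>x. c (fst x) (snd x)"
  have finX: "finite ?X" using fin by simp
  have fibre: "(\<Sum>I\<in>S j. f (j, I)) = (\<Sum>x\<in>?X. f x * of_bool (fst x = j))"
    if "j \<in> K" for j and f :: "_ \<Rightarrow> real"
    by (intro sum_fibre fin that)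
  define cost where "cost = (\<lambda>(J, \<mu>). y J + (\<Sum>x\<in>?X. \<mu> x * ?c x))"
  define feasible where "feasible = (\<lambda>(J, \<mu>). J \<in> A \<and> doubled_mixture n K S E \<mu> J)"
  define best where "best p \<longleftrightarrow> feasible p \<and> (\<forall>p'. feasible p' \<longrightarrow> cost p \<le> cost p')" for p
  define supp where "supp p = {x\<in>?X. snd p x \<noteq> 0}" for p :: "expo \<times> ('i \<times> expo \<Rightarrow> real)"
  have "\<exists>p. best p"
  proof -
    define A' where "A' = {J\<in>A. \<exists>\<mu>. feasible (J, \<mu>)}"
    have "\<forall>J\<in>A'. \<exists>\<mu>. feasible (J, \<mu>) \<and> (\<forall>\<mu>'. feasible (J, \<mu>') \<longrightarrow> cost (J, \<mu>) \<le> cost (J, \<mu>'))"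
    proof
      fix J assume "J \<in> A'"
      then obtain \<mu>1 where "J \<in> A" "doubled_mixture n K S E \<mu>1 J" by (auto simp: A'_def feasible_def)
      then show "\<exists>\<mu>. feasible (J, \<mu>) \<and> (\<forall>\<mu>'. feasible (J, \<mu>') \<longrightarrow> cost (J, \<mu>) \<le> cost (J, \<mu>'))"
        using cheapest_mixture_exists[OF fin \<open>doubled_mixture n K S E \<mu>1 J\<close>, of ?c]
        by (auto simp: feasible_def cost_def)
    qed
    then obtain M where M: "\<And>J. J \<in> A' \<Longrightarrow> feasible (J, M J)"
      "\<And>J \<mu>'. J \<in> A' \<Longrightarrow> feasible (J, \<mu>') \<Longrightarrow> cost (J, M J) \<le> cost (J, \<mu>')" by metis
    have "finite A'" "J0 \<in> A'" using \<open>finite A\<close> start by (auto simp: A'_def feasible_def)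
    moreover from this have "Min ((\<lambda>J. cost (J, M J)) ` A') \<in> (\<lambda>J. cost (J, M J)) ` A'"
      by (intro Min_in) auto
    ultimately obtain J where J: "J \<in> A'" "\<And>J'. J' \<in> A' \<Longrightarrow> cost (J, M J) \<le> cost (J', M J')"
      by (smt (verit) Min_le finite_imageI imageE imageI)
    have "best (J, M J)"
      unfolding best_def
    proof (intro conjI allI impI)
      show "feasible (J, M J)" using M J by blast
      fix p assume p: "feasible p"
      then have "fst p \<in> A'" by (cases p) (auto simp: A'_def feasible_def)
      then show "cost (J, M J) \<le> cost p" using J(2) M(2)[of "fst p" "snd p"] p by force
    qed
    then show ?thesis by blast
  qed
  then obtain p where p: "best p" "\<And>q. best q \<Longrightarrow> card (supp q) \<le> card (supp p)"
    using ex_has_greatest_nat[of best _ "\<lambda>p. card (supp p)" "Suc (card ?X)"] card_mono[OF finX]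
    by (metis (no_types, lifting) le_imp_less_Suc mem_Collect_eq subsetI supp_def)
  obtain J \<mu> where p_eq: "p = (J, \<mu>)" by fastforce
  have mix: "J \<in> A" "doubled_mixture n K S E \<mu> J" using p(1) by (auto simp: p_eq best_def feasible_def)
  have maximal: "\<not> supp (J, \<mu>) \<subset> supp (J', \<mu>')"
    if "J' \<in> A" "doubled_mixture n K S E \<mu>' J'" "cost (J', \<mu>') \<le> cost (J, \<mu>)" for J' \<mu>'
  proof -
    have "best (J', \<mu>')" using that p(1) by (force simp: p_eq best_def feasible_def)
    from p(2)[OF this] show ?thesis
      using psubset_card_mono[of "supp (J', \<mu>')" "supp p"] finX by (auto simp: p_eq supp_def)
  qed
  have optimal: "cost (J, \<mu>) \<le> cost (J', \<mu>')"
    if "J' \<in> A" "doubled_mixture n K S E \<mu>' J'" for J' \<mu>'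
    using p(1) that by (auto simp: p_eq best_def feasible_def)
  have nonneg: "0 \<le> \<mu> x" for x using mix by (cases x) (simp add: doubled_mixture_def)
  let ?Z = "supp (J, \<mu>)"
  have Z: "?Z \<subseteq> ?X" "finite ?Z" using finX by (auto simp: supp_def)
  have KX: "fst ` ?X \<subseteq> K" by auto
  show ?thesis
  proof (rule strict_complementarity[OF fin(1) finX KX Z(1), of ?c n])
    fix a t
    assume eq: "\<And>x. x \<in> ?Z \<Longrightarrow> ?c x + (\<Sum>w<n. a w * real (snd x w)) = t (fst x)"
      and gt: "\<And>x. x \<in> ?X - ?Z \<Longrightarrow> t (fst x) < ?c x + (\<Sum>w<n. a w * real (snd x w))"
    obtain i v where i: "i \<in> K" "v \<in> S i" and sing: "\<And>I. I \<in> S i \<Longrightarrow> I \<noteq> v \<Longrightarrow>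
        c i v + (\<Sum>w<n. a w * real (v w)) < c i I + (\<Sum>w<n. a w * real (I w))"
      using no_root[of a] by blast
    have t: "t i \<le> c i v + (\<Sum>w<n. a w * real (v w))"
      using eq[of "(i, v)"] gt[of "(i, v)"] i by fastforce
    have zero: "\<mu> (i, I) = 0" if "I \<in> S i" "I \<noteq> v" for I
      using eq[of "(i, I)"] sing[OF that] t i that by (fastforce simp: supp_def)
    have "(\<Sum>I\<in>S i. \<mu> (i, I)) = \<mu> (i, v) + (\<Sum>I\<in>S i - {v}. \<mu> (i, I))"
      using fin i by (intro sum.remove) auto
    then have two: "\<mu> (i, v) = 2" using zero i mix(2) by (simp add: doubled_mixture_def)
    have le: "\<forall>w<n. v w \<le> J w"
      using doubled_mixture_weight_le[OF fin mix(2) i] two by auto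
    show thesis
    proof (rule that[OF i mix two le])
      fix I assume I: "I \<in> S i" "I \<noteq> v" and A': "(\<lambda>w. J w - v w + I w) \<in> A"
      show "c i v + y J < c i I + y (\<lambda>w. J w - v w + I w)"
      proof (rule ccontr)
        assume neg: "\<not> ?thesis"
        define \<mu>' where "\<mu>' = (\<lambda>x. \<mu> x + of_bool (x = (i, I)) - of_bool (x = (i, v)))"
        have *: "doubled_mixture n K S E \<mu>' (\<lambda>w. J w - v w + I w)"
          "(\<Sum>x\<in>?X. \<mu>' x * ?c x) = (\<Sum>x\<in>?X. \<mu> x * ?c x) + ?c (i, I) - ?c (i, v)"
          using doubled_mixture_exchange(1,2)[OF fin mix(2) i I] two by (auto simp: \<mu>'_def)
        have "supp (J, \<mu>) \<subset> supp (\<lambda>w. J w - v w + I w, \<mu>')"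
          using zero[OF I] I i two by (auto simp: supp_def \<mu>'_def)
        with maximal[OF A' *(1)] show False using neg *(2) by (auto simp: cost_def)
      qed
    qed
  next
    fix \<nu>
    assume \<nu>: "\<And>x. x \<in> ?X - ?Z \<Longrightarrow> 0 \<le> \<nu> x"
      "\<And>w. w < n \<Longrightarrow> (\<Sum>x\<in>?X. \<nu> x * real (snd x w)) = 0"
      "\<And>i. i \<in> K \<Longrightarrow> (\<Sum>x\<in>?X. \<nu> x * of_bool (fst x = i)) = 0"
      "(\<Sum>x\<in>?X. \<nu> x * ?c x) \<le> 0" "(\<Sum>x\<in>?X. \<nu> x * ?c x) < 0 \<or> (\<exists>x\<in>?X - ?Z. 0 < \<nu> x)"
    have "\<And>x. x \<in> ?Z \<Longrightarrow> 0 < \<mu> x" using nonneg by (simp add: supp_def less_le)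
    from positive_perturbation[where \<mu> = \<mu> and \<nu> = \<nu>, OF Z(2) this] obtain \<epsilon> where \<epsilon>: "\<epsilon> > 0" "\<And>x. x \<in> ?Z \<Longrightarrow> 0 < \<mu> x + \<epsilon> * \<nu> x"
      by blast
    define \<mu>' where "\<mu>' x = (if x \<in> ?X then \<mu> x + \<epsilon> * \<nu> x else 0)" for x
    have sum_eq: "(\<Sum>x\<in>?X. \<mu>' x * f x) = (\<Sum>x\<in>?X. \<mu> x * f x) + \<epsilon> * (\<Sum>x\<in>?X. \<nu> x * f x)" for f
      by (simp add: \<mu>'_def algebra_simps sum.distrib sum_distrib_left cong: sum.cong)
    have "doubled_mixture n K S E \<mu>' J"
      unfolding doubled_mixture_def
    proof (intro conjI allI impI ballI)
      show "0 \<le> \<mu>' x" for x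
        using \<epsilon> \<nu>(1)[of x] nonneg[of x] by (cases "x \<in> ?Z") (force simp: \<mu>'_def less_imp_le)+
      show "\<mu>' x = 0" if "x \<notin> ?X" for x using that by (simp add: \<mu>'_def)
      show "(\<Sum>I\<in>S j. \<mu>' (j, I)) = 2" if "j \<in> K" for j
        using fibre[OF that, of \<mu>'] fibre[OF that, of \<mu>] sum_eq \<nu>(3)[OF that] mix that
        by (simp add: doubled_mixture_def)
      show "real (J w) = real (E w) + (\<Sum>x\<in>?X. \<mu>' x * real (snd x w))" if "w < n" for w
        using mix \<nu>(2)[OF that] that by (subst sum_eq) (simp add: doubled_mixture_def)
    qed
    note * = optimal[OF mix(1) this] maximal[OF mix(1) this]
    have cost': "cost (J, \<mu>') = cost (J, \<mu>) + \<epsilon> * (\<Sum>x\<in>?X. \<nu> x * ?c x)" by (simp add: cost_def sum_eq)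
    have "\<not> (\<Sum>x\<in>?X. \<nu> x * ?c x) < 0"
      using *(1) \<epsilon>(1) by (simp add: cost' zero_le_mult_iff)
    then obtain x where x: "x \<in> ?X - ?Z" "0 < \<nu> x" using \<nu>(5) by blast
    have "supp (J, \<mu>) \<subset> supp (J, \<mu>')"
    proof
      show "supp (J, \<mu>) \<subseteq> supp (J, \<mu>')"
        using \<epsilon>(2) by (force simp: supp_def \<mu>'_def)
      have "x \<in> supp (J, \<mu>')" using x \<epsilon>(1) by (auto simp: supp_def \<mu>'_def)
      then show "supp (J, \<mu>) \<noteq> supp (J, \<mu>')" using x by blast
    qed
    with *(2) show thesis using \<nu>(4) \<epsilon>(1) by (simp add: cost' mult_nonneg_nonpos)
  qed
qed

section \<open>Roots, Macaulay systems and nonsingular combinations\<close>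

definition mdeg :: "nat \<Rightarrow> expo \<Rightarrow> nat" where "mdeg n I = (\<Sum>v<n. I v)"

definition coef :: "tpoly \<Rightarrow> expo \<Rightarrow> real" where "coef f I = real_of_ereal (f I)"

definition slope :: "nat \<Rightarrow> (nat \<Rightarrow> real) \<Rightarrow> expo \<Rightarrow> real" where
  "slope n a I = (\<Sum>w<n. a w * real (I w))"

text \<open>
  The monomials of \<open>f\<close> that stay finite when the variables outside \<open>U\<close> are set to \<open>\<infinity>\<close>.
\<close>

definition face :: "tpoly \<Rightarrow> nat set \<Rightarrow> expo set" where
  "face f U = {I\<in>monomials f. \<forall>v. I v \<noteq> 0 \<longrightarrow> v \<in> U}"

definition shift :: "expo \<Rightarrow> expo \<Rightarrow> expo" where "shift E I = (\<lambda>v. E v + I v)"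

text \<open>
  Being a root, at the point with real coordinates \<open>a\<close> in \<open>U\<close> and coordinates \<open>\<infinity>\<close> elsewhere, in purely
  real terms; see \<open>troot_face_iff\<close>. It holds trivially if no monomial is finite.
\<close>

definition no_strict_minimum :: "nat \<Rightarrow> tpoly \<Rightarrow> nat set \<Rightarrow> (nat \<Rightarrow> real) \<Rightarrow> bool" where
  "no_strict_minimum n f U a \<longleftrightarrow>
     (\<forall>v\<in>face f U. \<exists>I\<in>face f U - {v}. coef f I + slope n a I \<le> coef f v + slope n a v)"

lemma tpoly_finite: "tpoly_Rinf n f \<Longrightarrow> finite (monomials f)"
  and tpoly_exponents: "tpoly_Rinf n f \<Longrightarrow> I \<in> monomials f \<Longrightarrow> I \<in> exponents n"
  by (auto simp: tpoly_Rinf_def)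

lemma exponents_support: "I \<in> exponents n \<Longrightarrow> I v \<noteq> 0 \<Longrightarrow> v < n"
  by (rule ccontr) (simp add: exponents_def)

lemma coef_eq: "tpoly_Rinf n f \<Longrightarrow> I \<in> monomials f \<Longrightarrow> f I = ereal (coef f I)"
  by (auto simp: tpoly_Rinf_def monomials_def coef_def ereal_real)

lemma mdeg_le_tdegree:
  assumes "tpoly_Rinf n f" "I \<in> monomials f"
  shows "mdeg n I \<le> tdegree n f"
  using assms tpoly_finite[OF assms(1)] by (auto simp: tdegree_def mdeg_def intro!: Max_ge)

lemma tdegree_le:
  assumes "finite (monomials f)" "\<And>I. I \<in> monomials f \<Longrightarrow> mdeg n I \<le> N"
  shows "tdegree n f \<le> N"
  using assms by (auto simp: tdegree_def mdeg_def intro!: Max.boundedI)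

lemma mdeg_shift: "mdeg n (shift E I) = mdeg n E + mdeg n I"
  by (simp add: mdeg_def shift_def sum.distrib)

lemma slope_shift: "slope n a (shift E I) = slope n a E + slope n a I"
  by (simp add: slope_def shift_def sum.distrib algebra_simps)

lemma shift_exponents: "E \<in> exponents n \<Longrightarrow> I \<in> exponents n \<Longrightarrow> shift E I \<in> exponents n"
  by (simp add: exponents_def shift_def)

lemma finite_exponents: "finite {J \<in> exponents n. mdeg n J \<le> N}"
proof (rule finite_subset)
  show "{J \<in> exponents n. mdeg n J \<le> N} \<subseteq> {J. \<forall>v. (v \<in> {..<n} \<longrightarrow> J v \<in> {..N}) \<and> (v \<notin> {..<n} \<longrightarrow> J v = 0)}"
  proof (clarsimp simp: exponents_def mdeg_def)
    fix J v assume "sum J {..<n} \<le> N" "v < n"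
    then show "J v \<le> N" using member_le_sum[of v "{..<n}" J] by simp
  qed
qed (rule finite_set_of_finite_funs; simp)

lemma mono_value_face:
  assumes f: "tpoly_Rinf n f" "I \<in> monomials f" and a': "\<And>v. v < n \<Longrightarrow> a' v = (if v \<in> U then ereal (a v) else \<infinity>)"
  shows "mono_value n f I a' = (if I \<in> face f U then ereal (coef f I + slope n a I) else \<infinity>)"
proof (cases "I \<in> face f U")
  case True
  have "(\<Sum>v<n. ereal (real (I v)) * a' v) = (\<Sum>v<n. ereal (a v * real (I v)))"
    using True by (intro sum.cong) (auto simp: a' face_def)
  then show ?thesis using True by (simp add: mono_value_def slope_def coef_eq[OF f])
next
  case False
  then obtain v where v: "I v \<noteq> 0" "v \<notin> U" using f by (auto simp: face_def)
  then have "v < n" using exponents_support[OF tpoly_exponents[OF f]] by blast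
  then have "(\<Sum>v<n. ereal (real (I v)) * a' v) = \<infinity>"
    using v by (subst sum_Pinfty) (auto intro!: bexI[of _ v] simp: a')
  then show ?thesis using False by (simp add: mono_value_def)
qed

lemma troot_face_iff:
  assumes f: "tpoly_Rinf n f" and a': "\<And>v. v < n \<Longrightarrow> a' v = (if v \<in> U then ereal (a v) else \<infinity>)"
  shows "troot n f a' \<longleftrightarrow> no_strict_minimum n f U a"
proof -
  note val = mono_value_face[OF f _ a']
  have sub: "face f U \<subseteq> monomials f" by (auto simp: face_def)
  have fin: "finite (face f U)" using tpoly_finite[OF f] sub finite_subset by blast
  let ?h = "\<lambda>I. coef f I + slope n a I"
  show ?thesis
  proof (cases "face f U = {}")
    case True
    then have "tvalue n f a' = \<infinity>" unfolding tvalue_def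
      by (intro antisym INF_greatest) (auto simp: val)
    then show ?thesis using True by (simp add: troot_def no_strict_minimum_def)
  next
    case False
    have "Min (?h ` face f U) \<in> ?h ` face f U" using fin False by (intro Min_in) auto
    then obtain v where v: "v \<in> face f U" "\<And>I. I \<in> face f U \<Longrightarrow> ?h v \<le> ?h I"
      using fin by (smt (verit) Min_le finite_imageI imageE imageI)
    have tv: "tvalue n f a' = ereal (?h v)" unfolding tvalue_def
    proof (rule antisym)
      show "(INF I\<in>monomials f. mono_value n f I a') \<le> ereal (?h v)"
        using v(1) sub by (intro INF_lower2[of v]) (auto simp: val)
      show "ereal (?h v) \<le> (INF I\<in>monomials f. mono_value n f I a')"
        using v(2) by (intro INF_greatest) (auto simp: val)
    qed
    have minimal: "mono_value n f I a' = tvalue n f a' \<longleftrightarrow> I \<in> face f U \<and> ?h I = ?h v" if "I \<in> monomials f" for I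
      using that by (auto simp: val tv)
    show ?thesis
    proof
      assume "troot n f a'"
      then obtain I J where IJ: "I \<in> face f U" "J \<in> face f U" "I \<noteq> J" "?h I = ?h v" "?h J = ?h v"
        unfolding troot_def using minimal by (auto simp: tv)
      have "\<exists>I\<in>face f U - {w}. ?h I \<le> ?h w" if "w \<in> face f U" for w
      proof (cases "w = I")
        case True
        then show ?thesis using v(2)[OF that] IJ by (intro bexI[of _ J]) auto
      next
        case False
        then show ?thesis using v(2)[OF that] IJ by (intro bexI[of _ I]) auto
      qed
      then show "no_strict_minimum n f U a" by (simp add: no_strict_minimum_def)
    next
      assume "no_strict_minimum n f U a"
      then obtain I where "I \<in> face f U" "I \<noteq> v" "?h I \<le> ?h v"
        using v(1) by (auto simp: no_strict_minimum_def)
      moreover from this have "?h I = ?h v" using v(2)[of I] by simp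
      ultimately show "troot n f a'" unfolding troot_def using v(1) sub minimal by blast
    qed
  qed
qed

lemma has_root_R_iff:
  assumes "\<And>i. i < k \<Longrightarrow> tpoly_Rinf n (F i)"
  shows "has_root_R n k F \<longleftrightarrow> (\<exists>a. \<forall>i<k. no_strict_minimum n (F i) UNIV a)"
proof -
  have "troot n (F i) (\<lambda>v. ereal (a v)) \<longleftrightarrow> no_strict_minimum n (F i) UNIV a" if "i < k" for i a
    by (rule troot_face_iff[OF assms[OF that]]) simp
  then show ?thesis by (simp add: has_root_R_def)
qed

lemma has_root_Rinf_iff:
  assumes F: "\<And>i. i < k \<Longrightarrow> tpoly_Rinf n (F i)"
  shows "has_root_Rinf n k F \<longleftrightarrow> (\<exists>U a. \<forall>i<k. no_strict_minimum n (F i) U a)"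
proof
  assume "has_root_Rinf n k F"
  then obtain a where a: "\<And>v. v < n \<Longrightarrow> a v \<noteq> -\<infinity>" "\<And>i. i < k \<Longrightarrow> troot n (F i) a"
    by (auto simp: has_root_Rinf_def)
  have "no_strict_minimum n (F i) {v. a v \<noteq> \<infinity>} (\<lambda>v. real_of_ereal (a v))" if "i < k" for i
    by (rule troot_face_iff[THEN iffD1, OF F[OF that] _ a(2)[OF that]]) (use a(1) in \<open>auto simp: ereal_real\<close>)
  then show "\<exists>U a. \<forall>i<k. no_strict_minimum n (F i) U a" by blast
next
  assume "\<exists>U a. \<forall>i<k. no_strict_minimum n (F i) U a"
  then obtain U a where *: "\<And>i. i < k \<Longrightarrow> no_strict_minimum n (F i) U a" by blast
  have "troot n (F i) (\<lambda>v. if v \<in> U then ereal (a v) else \<infinity>)" if "i < k" for i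
    using troot_face_iff[OF F[OF that]] *[OF that] by auto
  then show "has_root_Rinf n k F" unfolding has_root_Rinf_def
    by (intro exI[of _ "\<lambda>v. if v \<in> U then ereal (a v) else \<infinity>"]) auto
qed

lemma mono_mult_eq:
  assumes "tpoly_Rinf n f"
  shows "mono_mult c E f J =
    (if J \<in> shift E ` monomials f then ereal (c + coef f (\<lambda>v. J v - E v)) else \<infinity>)"
proof (cases "J \<in> shift E ` monomials f")
  case True
  then obtain I where "I \<in> monomials f" "J = shift E I" by blast
  moreover from this have "(\<lambda>v. J v - E v) = I" "E \<le> J" by (auto simp: shift_def le_fun_def)
  ultimately show ?thesis using True coef_eq[OF assms] by (simp add: mono_mult_def)
next
  case False
  have "f (\<lambda>v. J v - E v) = \<infinity>" if "E \<le> J"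
  proof (rule ccontr)
    assume "\<not> ?thesis"
    moreover have "J = shift E (\<lambda>v. J v - E v)" using that by (auto simp: shift_def le_fun_def)
    ultimately show False using False by (auto simp: monomials_def)
  qed
  then show ?thesis using False by (simp add: mono_mult_def)
qed

lemma tsum_finite_iff:
  assumes "1 \<le> K"
  shows "I \<in> monomials (tsum K G) \<longleftrightarrow> (\<exists>j<K. G j I \<noteq> \<infinity>)"
proof -
  have "Min ((\<lambda>j. G j I) ` {..<K}) \<in> (\<lambda>j. G j I) ` {..<K}" using assms by (intro Min_in) (auto simp: lessThan_empty_iff)
  moreover have "Min ((\<lambda>j. G j I) ` {..<K}) \<le> G j I" if "j < K" for j using that by (intro Min_le) auto
  ultimately show ?thesis by (fastforce simp: monomials_def tsum_def)
qed

lemma tsum_mono_mult_monomials: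
  assumes "1 \<le> K" "\<And>j. j < K \<Longrightarrow> tpoly_Rinf n (f j)"
  shows "monomials (tsum K (\<lambda>j. mono_mult (c j) (E j) (f j))) = (\<Union>j<K. shift (E j) ` monomials (f j))"
proof -
  have "mono_mult (c j) (E j) (f j) I \<noteq> \<infinity> \<longleftrightarrow> I \<in> shift (E j) ` monomials (f j)" if "j < K" for j I
    by (simp add: mono_mult_eq[OF assms(2)[OF that]])
  then show ?thesis unfolding set_eq_iff tsum_finite_iff[OF assms(1)] by blast
qed

lemma nonsingular_combination_nonempty:
  assumes F: "\<And>i. i < k \<Longrightarrow> tpoly_R n (F i)" and g: "nonsingular_combination n k F g"
  shows "monomials g \<noteq> {}"
proof -
  obtain K c E s where K: "1 \<le> K" "\<forall>j<K. E j \<in> exponents n \<and> s j < k"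
    and g_eq: "g = tsum K (\<lambda>j. mono_mult (c j) (E j) (F (s j)))"
    using g unfolding nonsingular_combination_def by blast
  have Fs: "tpoly_R n (F (s j))" if "j < K" for j using F K(2) that by blast
  have "monomials g = (\<Union>j<K. shift (E j) ` monomials (F (s j)))"
    unfolding g_eq by (rule tsum_mono_mult_monomials[where n = n, OF K(1)]) (use Fs in \<open>simp add: tpoly_R_def\<close>)
  then show ?thesis using Fs[of 0] K(1) by (auto simp: tpoly_R_def)
qed

text \<open>
  Let \<open>h m\<close> be the value at the root of the monomial \<open>m\<close> of \<open>g\<close>, and consider a monomial \<open>m\<close> of minimal
  finite value. The summand with index \<open>l m\<close> has the same root, so it has a further monomial \<open>m'\<close> whose
  value there is at most \<open>h m\<close>. In \<open>g\<close> the coefficient of \<open>m'\<close> is strictly smaller than in this summand,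
  since \<open>l m' \<noteq> l m\<close>; thus \<open>h m' < h m\<close>.
\<close>

theorem nonsingular_combination_excludes_root:
  assumes F: "\<And>i. i < k \<Longrightarrow> tpoly_Rinf n (F i)"
    and g: "nonsingular_combination n k F g"
    and root: "\<And>i. i < k \<Longrightarrow> no_strict_minimum n (F i) U a"
    and m0: "m0 \<in> face g U"
  shows False
proof -
  obtain K c E s where K': "1 \<le> K" "\<forall>j<K. E j \<in> exponents n \<and> s j < k"
    and g_eq: "g = tsum K (\<lambda>j. mono_mult (c j) (E j) (F (s j)))"
    and ns: "nonsingular K (\<lambda>j. mono_mult (c j) (E j) (F (s j)))"
    using g unfolding nonsingular_combination_def by blast
  have K: "1 \<le> K" "\<And>j. j < K \<Longrightarrow> s j < k" using K' by auto
  define G where "G j = mono_mult (c j) (E j) (F (s j))" for j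
  have Gg: "g = tsum K G" using g_eq by (simp add: G_def[abs_def])
  have "nonsingular K G" using ns by (simp add: G_def[abs_def])
  then obtain l where "\<forall>I\<in>monomials g. l I < K \<and> (\<forall>j<K. j \<noteq> l I \<longrightarrow> G (l I) I < G j I)"
    and inj: "inj_on l (monomials g)"
    unfolding nonsingular_def Gg by blast
  then have l: "\<And>I. I \<in> monomials g \<Longrightarrow> l I < K"
    "\<And>I j. I \<in> monomials g \<Longrightarrow> j < K \<Longrightarrow> j \<noteq> l I \<Longrightarrow> G (l I) I < G j I"
    by blast+
  have G_val: "G j J = (if J \<in> shift (E j) ` monomials (F (s j))
      then ereal (c j + coef (F (s j)) (\<lambda>v. J v - E j v)) else \<infinity>)" if "j < K" for j J
    unfolding G_def by (rule mono_mult_eq[OF F[OF K(2)[OF that]]])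
  have mono_g: "I \<in> monomials g \<longleftrightarrow> (\<exists>j<K. G j I \<noteq> \<infinity>)" for I
    unfolding Gg by (rule tsum_finite_iff[OF K(1)])
  have fin_l: "G (l I) I \<noteq> \<infinity>" if "I \<in> monomials g" for I
  proof -
    from mono_g[THEN iffD1, OF that] obtain j where "j < K" "G j I \<noteq> \<infinity>" by (elim exE conjE)
    show ?thesis
    proof (cases "j = l I")
      case False
      then have "G (l I) I < G j I" using l(2)[OF that] \<open>j < K\<close> by blast
      also have "\<dots> \<le> \<infinity>" by simp
      finally show ?thesis by simp
    qed (use \<open>G j I \<noteq> \<infinity>\<close> in blast)
  qed
  have "finite (monomials g)"
    unfolding g_eq
    by (subst tsum_mono_mult_monomials[where n = n, OF K(1)]) (auto intro: F K(2) tpoly_finite[where n = n])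
  then have fin: "finite (face g U)" by (simp add: face_def)
  define h where "h m = real_of_ereal (G (l m) m) + slope n a m" for m
  have "Min (h ` face g U) \<in> h ` face g U" using fin m0 by (intro Min_in) auto
  then obtain m where m: "m \<in> face g U" "\<And>m'. m' \<in> face g U \<Longrightarrow> h m \<le> h m'"
    using fin by (smt (verit) Min_le finite_imageI imageE imageI)
  define j f where "j = l m" and "f = F (s j)"
  have mg: "m \<in> monomials g" and j: "j < K" using m l by (auto simp: face_def j_def)
  have "G j m \<noteq> \<infinity>" using fin_l[OF mg] by (simp add: j_def)
  have "m \<in> shift (E j) ` monomials f"
  proof (rule ccontr)
    assume "\<not> ?thesis"
    with G_val[OF j, of m] \<open>G j m \<noteq> \<infinity>\<close> show False by (simp add: f_def)
  qed
  then obtain I where I: "I \<in> monomials f" "m = shift (E j) I" by blast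
  have "I \<in> face f U" using I m(1) by (auto simp: face_def shift_def)
  then obtain I' where I': "I' \<in> face f U" "I' \<noteq> I" "coef f I' + slope n a I' \<le> coef f I + slope n a I"
    using root[OF K(2)[OF j]] by (auto simp: no_strict_minimum_def f_def)
  define m' where "m' = shift (E j) I'"
  have G': "G j m' = ereal (c j + coef f I')"
    using G_val[OF j, of m'] I'(1) by (auto simp: m'_def f_def face_def shift_def image_iff)
  have G: "G j m = ereal (c j + coef f I)"
    using G_val[OF j, of m] I by (auto simp: f_def shift_def image_iff)
  have m'g: "m' \<in> monomials g" using G' j mono_g by auto
  then have m'U: "m' \<in> face g U" using I'(1) m(1) I by (auto simp: face_def m'_def shift_def)
  obtain w where "I' w \<noteq> I w" using I'(2) by blast
  then have "m' \<noteq> m" by (auto simp: m'_def I shift_def dest: fun_cong[of _ _ w])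
  then have "j \<noteq> l m'" using inj m'g mg by (auto simp: inj_on_def j_def)
  then have lt: "G (l m') m' < ereal (c j + coef f I')" using l(2)[OF m'g j] G' by simp
  then have "real_of_ereal (G (l m') m') < c j + coef f I'"
    using G_val[OF l(1)[OF m'g], of m'] fin_l[OF m'g] by (auto split: if_splits)
  moreover have hm: "h m = c j + coef f I + slope n a m" using G by (simp add: h_def j_def)
  ultimately have "h m' < h m"
    using I'(3) hm by (simp add: h_def m'_def I(2) slope_shift)
  with m(2)[OF m'U] show False by simp
qed

text \<open>
  A solution, with finite part \<open>D\<close>, of the tropical linear system whose columns are the monomials of
  degree at most \<open>N\<close> and whose rows are the multiples \<open>x\<^sup>E \<odot> f\<^sub>i\<close> within this degree. That each minimum is
  attained twice or is \<open>\<infinity>\<close> is expressed by giving every finite entry another one that is at most as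
  large.
\<close>

definition macaulay_solution :: "nat \<Rightarrow> nat \<Rightarrow> (nat \<Rightarrow> tpoly) \<Rightarrow> nat \<Rightarrow> expo set \<Rightarrow> (expo \<Rightarrow> real) \<Rightarrow> bool" where
  "macaulay_solution n k F N D y \<longleftrightarrow>
     D \<subseteq> {J \<in> exponents n. mdeg n J \<le> N} \<and>
     (\<forall>i<k. \<forall>E\<in>exponents n. mdeg n E + tdegree n (F i) \<le> N \<longrightarrow>
        (\<forall>I\<in>monomials (F i). shift E I \<in> D \<longrightarrow>
           (\<exists>I'\<in>monomials (F i). I' \<noteq> I \<and> shift E I' \<in> D \<and>
              coef (F i) I' + y (shift E I') \<le> coef (F i) I + y (shift E I))))"

text \<open>
  Linear duality turned into polynomials. The scaling \<open>- A (\<rho> m) m - u m\<close> of the witness row of \<open>m\<close> makes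
  its entry at \<open>m\<close> equal to \<open>- u m\<close>, and its entries at all other columns \<open>m'\<close> greater than \<open>- u m'\<close>. So
  every column has its strict minimum in its own row, which is nonsingularity.
\<close>

theorem macaulay_alternative:
  assumes F: "\<And>i. i < k \<Longrightarrow> tpoly_Rinf n (F i)"
  shows "\<exists>D y. macaulay_solution n k F N D y \<and>
    ({J \<in> exponents n. mdeg n J \<le> N} - D \<noteq> {} \<longrightarrow>
       (\<exists>g. nonsingular_combination n k F g \<and> tdegree n g \<le> N \<and>
           monomials g = {J \<in> exponents n. mdeg n J \<le> N} - D))"
proof -
  define C where "C = {J \<in> exponents n. mdeg n J \<le> N}"
  define R where "R = {(i, E). i < k \<and> E \<in> exponents n \<and> mdeg n E + tdegree n (F i) \<le> N}"
  define A where "A = (\<lambda>(i, E) J. coef (F i) (\<lambda>v. J v - E v))"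
  define Sp where "Sp = (\<lambda>(i, E). shift E ` monomials (F i))"
  have A_shift: "A (i, E) (shift E I) = coef (F i) I" for i E I by (simp add: A_def shift_def)
  have finC: "finite C" unfolding C_def by (rule finite_exponents)
  have "R \<subseteq> {..<k} \<times> C" by (auto simp: R_def C_def)
  then have finR: "finite R" using finC by (meson finite_SigmaI finite_lessThan finite_subset)
  have Sp: "Sp r \<subseteq> C" if "r \<in> R" for r
  proof
    fix J assume "J \<in> Sp r"
    then obtain i E I where *: "r = (i, E)" "J = shift E I" "I \<in> monomials (F i)" by (auto simp: Sp_def split: prod.splits)
    then have "i < k" "E \<in> exponents n" "mdeg n E + tdegree n (F i) \<le> N" using that by (auto simp: R_def)
    then show "J \<in> C"
      using * mdeg_le_tdegree[OF F, of i I] tpoly_exponents[OF F, of i I]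
      by (auto simp: C_def shift_exponents mdeg_shift)
  qed
  show ?thesis
  proof (rule linear_duality[where A = A and Sp = Sp, OF finC finR Sp])
    fix D and y u :: "expo \<Rightarrow> real"
    assume D: "D \<subseteq> C"
    and sol: "\<And>r m. r \<in> R \<Longrightarrow> m \<in> Sp r \<Longrightarrow> m \<in> D \<Longrightarrow>
       \<exists>m'\<in>Sp r. m' \<noteq> m \<and> m' \<in> D \<and> A r m' + y m' \<le> A r m + y m"
    and dom: "\<And>m. m \<in> C - D \<Longrightarrow>
       \<exists>r\<in>R. m \<in> Sp r \<and> Sp r \<subseteq> C - D \<and> (\<forall>m'\<in>Sp r - {m}. A r m + u m < A r m' + u m')"
  show ?thesis
  proof (intro exI[of _ D] exI[of _ y] conjI impI)
    show "macaulay_solution n k F N D y"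
      unfolding macaulay_solution_def
    proof (intro conjI allI impI ballI)
      show "D \<subseteq> {J \<in> exponents n. mdeg n J \<le> N}" using D by (simp add: C_def)
      fix i E I assume *: "i < k" "E \<in> exponents n" "mdeg n E + tdegree n (F i) \<le> N"
        "I \<in> monomials (F i)" "shift E I \<in> D"
      obtain m' where "m' \<in> Sp (i, E)" "m' \<noteq> shift E I" "m' \<in> D"
        "A (i, E) m' + y m' \<le> A (i, E) (shift E I) + y (shift E I)"
        using sol[of "(i, E)" "shift E I"] * by (auto simp: R_def Sp_def)
      then show "\<exists>I'\<in>monomials (F i). I' \<noteq> I \<and> shift E I' \<in> D \<and>
              coef (F i) I' + y (shift E I') \<le> coef (F i) I + y (shift E I)"
        by (auto simp: Sp_def A_shift)
    qed
  next
    assume "{J \<in> exponents n. mdeg n J \<le> N} - D \<noteq> {}"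
    define S where "S = C - D"
    have finS: "finite S" using finC by (simp add: S_def)
    define K where "K = card S"
    have K: "1 \<le> K" using \<open>_ \<noteq> {}\<close> finS by (simp add: K_def S_def C_def Suc_le_eq card_gt_0_iff)
    obtain e where e: "bij_betw e {..<K} S"
      using ex_bij_betw_nat_finite[OF finS] by (auto simp: K_def atLeast0LessThan)
    obtain \<rho> where \<rho>: "\<And>m. m \<in> S \<Longrightarrow> \<rho> m \<in> R \<and> m \<in> Sp (\<rho> m) \<and> Sp (\<rho> m) \<subseteq> S \<and>
        (\<forall>m'\<in>Sp (\<rho> m) - {m}. A (\<rho> m) m + u m < A (\<rho> m) m' + u m')"
      using dom unfolding S_def by metis
    define s where "s j = fst (\<rho> (e j))" for j
    define E where "E j = snd (\<rho> (e j))" for j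
    define c where "c j = - A (\<rho> (e j)) (e j) - u (e j)" for j
    define G where "G j = mono_mult (c j) (E j) (F (s j))" for j
    have eS: "e j \<in> S" if "j < K" for j using e that by (auto simp: bij_betw_def)
    have sE: "s j < k" "E j \<in> exponents n" if "j < K" for j
      using \<rho>[OF eS[OF that]] by (auto simp: s_def E_def R_def)
    have G_val: "G j J = (if J \<in> Sp (\<rho> (e j)) then ereal (c j + A (\<rho> (e j)) J) else \<infinity>)" if "j < K" for j J
      unfolding G_def mono_mult_eq[OF F[OF sE(1)[OF that]]] by (simp add: Sp_def A_def s_def E_def case_prod_unfold)
    have mono: "monomials (tsum K G) = S"
    proof -
      have "I \<in> monomials (tsum K G) \<longleftrightarrow> (\<exists>j<K. I \<in> Sp (\<rho> (e j)))" for I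
      proof -
        have "G j I \<noteq> \<infinity> \<longleftrightarrow> I \<in> Sp (\<rho> (e j))" if "j < K" for j using G_val[OF that] by simp
        then show ?thesis unfolding tsum_finite_iff[OF K] by blast
      qed
      then have "monomials (tsum K G) = (\<Union>m\<in>e ` {..<K}. Sp (\<rho> m))" by auto
      also have "e ` {..<K} = S" using e by (simp add: bij_betw_def)
      also have "(\<Union>m\<in>S. Sp (\<rho> m)) = S" using \<rho> by blast
      finally show ?thesis .
    qed
    define l where "l = inv_into {..<K} e"
    have l: "l I < K" "e (l I) = I" if "I \<in> S" for I
    proof -
      have "I \<in> e ` {..<K}" using that e by (simp add: bij_betw_def)
      then show "l I < K" "e (l I) = I" unfolding l_def
        using inv_into_into[of I e "{..<K}"] f_inv_into_f[of I e "{..<K}"] by simp_all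
    qed
    have "nonsingular K G"
      unfolding nonsingular_def mono
    proof (intro exI[of _ l] conjI ballI allI impI)
      show "inj_on l S" using l by (metis inj_on_inverseI)
      fix I assume I: "I \<in> S"
      then show "l I < K" by (rule l)
      fix j assume j: "j < K" "j \<noteq> l I"
      have "e j \<noteq> I" using j e l[OF I] by (auto simp: bij_betw_def inj_on_def)
      moreover have "G (l I) I = ereal (- u I)"
        using G_val[OF l(1)[OF I]] \<rho>[OF I] by (simp add: l(2)[OF I] c_def)
      ultimately show "G (l I) I < G j I"
        using G_val[OF j(1)] \<rho>[OF eS[OF j(1)]] by (force simp: c_def algebra_simps)
    qed
    then have "nonsingular_combination n k F (tsum K G)"
      unfolding nonsingular_combination_def
      by (intro exI[of _ K] exI[of _ c] exI[of _ E] exI[of _ s]) (use K sE in \<open>simp add: G_def[abs_def]\<close>)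
    moreover have "tdegree n (tsum K G) \<le> N"
      by (rule tdegree_le) (use finS in \<open>auto simp: mono S_def C_def\<close>)
    ultimately show "\<exists>g. nonsingular_combination n k F g \<and> tdegree n g \<le> N \<and>
           monomials g = {J \<in> exponents n. mdeg n J \<le> N} - D"
      using mono by (auto simp: S_def C_def)
  qed
  qed
qed

section \<open>Macaulay solutions of small degree\<close>

lemma mixture_sum_le:
  assumes fin: "finite K" "\<And>i. i \<in> K \<Longrightarrow> finite (S i)"
    and mix: "doubled_mixture n K S E \<mu> J"
    and \<phi>: "\<And>i I. i \<in> K \<Longrightarrow> I \<in> S i \<Longrightarrow> \<phi> (i, I) \<le> (b i :: real)"
  shows "(\<Sum>x\<in>Sigma K S. \<mu> x * \<phi> x) \<le> 2 * (\<Sum>i\<in>K. b i)"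
proof -
  have "(\<Sum>x\<in>Sigma K S. \<mu> x * \<phi> x) = (\<Sum>i\<in>K. \<Sum>I\<in>S i. \<mu> (i, I) * \<phi> (i, I))"
    by (rule sum_pairs[OF fin])
  also have "\<dots> \<le> (\<Sum>i\<in>K. \<Sum>I\<in>S i. \<mu> (i, I) * b i)"
    using mix \<phi> by (intro sum_mono mult_left_mono) (auto simp: doubled_mixture_def)
  also have "\<dots> = (\<Sum>i\<in>K. 2 * b i)"
    using mix by (intro sum.cong) (auto simp: doubled_mixture_def sum_distrib_right[symmetric])
  finally show ?thesis by (simp add: sum_distrib_left)
qed

text \<open>
  The starting points of the touching argument: one monomial from each block, taken twice.
\<close>

lemma mixture_of_choice:
  assumes fin: "finite K" "\<And>i. i \<in> K \<Longrightarrow> finite (S i)"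
    and \<omega>: "\<And>i. i \<in> K \<Longrightarrow> \<omega> i \<in> S i"
    and J: "\<And>w. w < n \<Longrightarrow> J w = E w + 2 * (\<Sum>i\<in>K. \<omega> i w)"
  shows "doubled_mixture n K S E (\<lambda>(i, I). if i \<in> K \<and> I = \<omega> i then 2 else 0) J"
  unfolding doubled_mixture_def
proof (intro conjI allI impI ballI)
  let ?\<mu> = "\<lambda>(i, I). if i \<in> K \<and> I = \<omega> i then 2 else 0 :: real"
  show "0 \<le> ?\<mu> x" for x by (auto split: prod.splits)
  show "?\<mu> x = 0" if "x \<notin> Sigma K S" for x using that \<omega> by (auto split: prod.splits)
  have row: "(\<Sum>I\<in>S i. ?\<mu> (i, I) * f I) = 2 * f (\<omega> i)" if "i \<in> K" for i and f :: "expo \<Rightarrow> real"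
  proof -
    have "(\<Sum>I\<in>S i. ?\<mu> (i, I) * f I) = (\<Sum>I\<in>S i. if I = \<omega> i then 2 * f I else 0)"
      using that by (intro sum.cong) auto
    then show ?thesis using fin(2)[OF that] \<omega>[OF that] by (simp add: sum.delta)
  qed
  show "(\<Sum>I\<in>S i. ?\<mu> (i, I)) = 2" if "i \<in> K" for i
    using row[OF that, of "\<lambda>_. 1"] by simp
  show "real (J w) = real (E w) + (\<Sum>x\<in>Sigma K S. ?\<mu> x * real (snd x w))" if "w < n" for w
  proof -
    have "(\<Sum>x\<in>Sigma K S. ?\<mu> x * real (snd x w)) = (\<Sum>i\<in>K. \<Sum>I\<in>S i. ?\<mu> (i, I) * real (I w))"
      by (subst sum_pairs[OF fin]) (simp_all only: snd_conv)
    also have "\<dots> = (\<Sum>i\<in>K. 2 * real (\<omega> i w))"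
      using row by (intro sum.cong) (auto simp del: split_conv case_prod_conv)
    finally show ?thesis using J[OF that] by (simp add: sum_distrib_left)
  qed
qed

lemma mixture_slope:
  assumes "doubled_mixture n K S E \<mu> J"
  shows "slope n p J = slope n p E + (\<Sum>x\<in>Sigma K S. \<mu> x * slope n p (snd x))"
proof -
  have "slope n p J = slope n p E + (\<Sum>w<n. \<Sum>x\<in>Sigma K S. p w * (\<mu> x * real (snd x w)))"
    unfolding slope_def sum.distrib[symmetric] using assms
    by (intro sum.cong) (auto simp: doubled_mixture_def algebra_simps sum_distrib_left)
  also have "(\<Sum>w<n. \<Sum>x\<in>Sigma K S. p w * (\<mu> x * real (snd x w))) = (\<Sum>x\<in>Sigma K S. \<mu> x * slope n p (snd x))"
    by (subst sum.swap) (simp add: slope_def sum_distrib_left mult.left_commute)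
  finally show ?thesis .
qed

lemma mdeg_eq_slope: "real (mdeg n I) = slope n (\<lambda>_. 1) I"
  by (simp add: mdeg_def slope_def)

lemma mixture_mdeg_le:
  assumes fin: "finite K" "\<And>i. i \<in> K \<Longrightarrow> finite (S i)"
    and mix: "doubled_mixture n K S E \<mu> J"
    and b: "\<And>i I. i \<in> K \<Longrightarrow> I \<in> S i \<Longrightarrow> mdeg n I \<le> b i"
  shows "mdeg n J \<le> mdeg n E + 2 * (\<Sum>i\<in>K. b i)"
proof -
  have "real (mdeg n J) = real (mdeg n E) + (\<Sum>x\<in>Sigma K S. \<mu> x * real (mdeg n (snd x)))"
    using mixture_slope[OF mix, of "\<lambda>_. 1"] by (simp add: mdeg_eq_slope)
  also have "(\<Sum>x\<in>Sigma K S. \<mu> x * real (mdeg n (snd x))) \<le> 2 * (\<Sum>i\<in>K. real (b i))"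
    by (rule mixture_sum_le[OF fin mix]) (use b in auto)
  finally show ?thesis by (simp flip: of_nat_sum)
qed

text \<open>
  The touching argument applied to a Macaulay solution and to the monomials that involve only variables
  in \<open>U\<close>. The touched row needs a second minimum; inside the face there is none, so the system must
  leave the face.
\<close>

lemma macaulay_solution_at_mixture:
  assumes F: "\<And>i. i < k \<Longrightarrow> tpoly_Rinf n (F i)"
    and sol: "macaulay_solution n k F N D y"
    and no_root: "\<And>a. \<not> (\<forall>i<k. no_strict_minimum n (F i) U a)"
    and start: "J0 \<in> D" "doubled_mixture n {i. i < k \<and> face (F i) U \<noteq> {}} (\<lambda>i. face (F i) U) E0 \<mu>0 J0"
    and N: "\<And>i. i < k \<Longrightarrow> mdeg n E0 + 2 * (\<Sum>i<k. tdegree n (F i)) + tdegree n (F i) \<le> N"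
  shows "\<exists>i v J \<mu> I. i < k \<and> v \<in> face (F i) U \<and> J \<in> D \<and>
    doubled_mixture n {i. i < k \<and> face (F i) U \<noteq> {}} (\<lambda>i. face (F i) U) E0 \<mu> J \<and> \<mu> (i, v) = 2 \<and>
    (\<forall>w. v w \<le> J w) \<and> I \<in> monomials (F i) \<and> I \<notin> face (F i) U \<and> shift (\<lambda>w. J w - v w) I \<in> D"
proof -
  let ?K = "{i. i < k \<and> face (F i) U \<noteq> {}}" and ?S = "\<lambda>i. face (F i) U"
  have sub: "face f U \<subseteq> monomials f" for f by (auto simp: face_def)
  have finK: "finite ?K" by simp
  have finS: "finite (?S i)" if "i \<in> ?K" for i
    using tpoly_finite[OF F, of i] sub finite_subset that by blast
  have D: "D \<subseteq> {J \<in> exponents n. mdeg n J \<le> N}" using sol by (simp add: macaulay_solution_def)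
  then have finD: "finite D" using finite_exponents finite_subset by blast
  show ?thesis
  proof (rule touching_mixture[where K = ?K and S = ?S and A = D and n = n and E = E0 and y = y
        and c = "\<lambda>i. coef (F i)", OF finK finS finD _ start])
    fix a :: "nat \<Rightarrow> real"
    show "\<exists>i\<in>?K. \<exists>v\<in>?S i. \<forall>I\<in>?S i - {v}.
      coef (F i) v + (\<Sum>w<n. a w * real (v w)) < coef (F i) I + (\<Sum>w<n. a w * real (I w))"
      using no_root[of a] unfolding no_strict_minimum_def slope_def by (force simp: not_le)
  next
    fix i v J \<mu>
    assume i: "i \<in> ?K" "v \<in> ?S i" and J: "J \<in> D" "doubled_mixture n ?K ?S E0 \<mu> J" "\<mu> (i, v) = 2"
      and vJ: "\<forall>w<n. v w \<le> J w"
      and touch: "\<And>I. I \<in> ?S i \<Longrightarrow> I \<noteq> v \<Longrightarrow> (\<lambda>w. J w - v w + I w) \<in> D \<Longrightarrow>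
        coef (F i) v + y J < coef (F i) I + y (\<lambda>w. J w - v w + I w)"
    define E where "E = (\<lambda>w. J w - v w)"
    have v: "v \<in> monomials (F i)" and ik: "i < k" using i sub by auto
    have "v w \<le> J w" for w
      using vJ tpoly_exponents[OF F[OF ik] v] by (cases "w < n") (auto simp: exponents_def)
    then have EJ: "shift E v = J" by (simp add: shift_def E_def)
    have "J \<in> exponents n" using J(1) D by blast
    then have E_exp: "E \<in> exponents n" by (simp add: exponents_def E_def)
    have "mdeg n J \<le> mdeg n E0 + 2 * (\<Sum>i\<in>?K. tdegree n (F i))"
      by (rule mixture_mdeg_le[OF finK finS J(2)]) (use F sub mdeg_le_tdegree in blast)+
    also have "(\<Sum>i\<in>?K. tdegree n (F i)) \<le> (\<Sum>i<k. tdegree n (F i))"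
      by (rule sum_mono2) auto
    finally have "mdeg n E + tdegree n (F i) \<le> N"
      using N[OF ik] mdeg_shift[of n E v] EJ by simp
    then have "shift E v \<in> D \<Longrightarrow> \<exists>I\<in>monomials (F i). I \<noteq> v \<and> shift E I \<in> D \<and>
        coef (F i) I + y (shift E I) \<le> coef (F i) v + y (shift E v)"
      using sol ik E_exp v unfolding macaulay_solution_def by blast
    then obtain I where I: "I \<in> monomials (F i)" "I \<noteq> v" "shift E I \<in> D"
      "coef (F i) I + y (shift E I) \<le> coef (F i) v + y J"
      using J(1) EJ by auto
    have "I \<notin> face (F i) U"
      using touch[of I] I by (auto simp: shift_def E_def)
    then show ?thesis
      using ik i(2) J \<open>\<And>w. v w \<le> J w\<close> I(1,3) unfolding E_def by blast
  qed
qed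

text \<open>
  With all variables finite, every monomial is in the face, so leaving the face is impossible.
\<close>

theorem macaulay_root_R:
  assumes F: "\<And>i. i < k \<Longrightarrow> tpoly_R n (F i)"
    and sol: "macaulay_solution n k F N {J \<in> exponents n. mdeg n J \<le> N} y"
    and N: "N = (n + 2) * (\<Sum>i<k. tdegree n (F i))"
  shows "has_root_R n k F"
proof (rule ccontr)
  assume no: "\<not> has_root_R n k F"
  let ?D = "{J \<in> exponents n. mdeg n J \<le> N}"
  have Fi: "tpoly_Rinf n (F i)" and ne: "monomials (F i) \<noteq> {}" if "i < k" for i
    using F[OF that] by (auto simp: tpoly_R_def)
  have face: "face f UNIV = monomials f" for f by (simp add: face_def)
  have K: "{i. i < k \<and> face (F i) UNIV \<noteq> {}} = {..<k}" using ne by (auto simp: face)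
  define \<omega> where "\<omega> i = (SOME I. I \<in> monomials (F i))" for i
  have \<omega>: "\<omega> i \<in> monomials (F i)" if "i < k" for i using ne[OF that] by (simp add: \<omega>_def some_in_eq)
  define J0 where "J0 w = 2 * (\<Sum>i<k. \<omega> i w)" for w
  have mix: "doubled_mixture n {..<k} (\<lambda>i. monomials (F i)) (\<lambda>_. 0)
      (\<lambda>(i, I). if i \<in> {..<k} \<and> I = \<omega> i then 2 else 0) J0"
    by (rule mixture_of_choice) (use \<omega> tpoly_finite[OF Fi] in \<open>auto simp: J0_def\<close>)
  have deg: "mdeg n (\<lambda>_. 0) + 2 * (\<Sum>i<k. tdegree n (F i)) + tdegree n (F i) \<le> N" if "i < k" for i
  proof -
    have "tdegree n (F i) \<le> n * (\<Sum>i<k. tdegree n (F i))"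
    proof (cases "n = 0")
      case True
      then have "tdegree n (F i) \<le> 0"
        using tpoly_finite[OF Fi[OF that]] by (intro tdegree_le) (auto simp: mdeg_def)
      then show ?thesis by simp
    next
      case False
      have "tdegree n (F i) \<le> (\<Sum>i<k. tdegree n (F i))" using that by (intro member_le_sum) auto
      also have "\<dots> \<le> n * (\<Sum>i<k. tdegree n (F i))" using False by simp
      finally show ?thesis .
    qed
    then show ?thesis by (simp add: N mdeg_def algebra_simps)
  qed
  have "mdeg n J0 \<le> mdeg n (\<lambda>_. 0) + 2 * (\<Sum>i<k. tdegree n (F i))"
    by (rule mixture_mdeg_le[OF _ _ mix]) (use Fi tpoly_finite mdeg_le_tdegree in auto)
  also have "\<dots> \<le> N" by (simp add: N mdeg_def)
  finally have J0: "J0 \<in> ?D"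
    using \<omega> tpoly_exponents[OF Fi] by (force simp: J0_def exponents_def)
  have none: "\<not> (\<forall>i<k. no_strict_minimum n (F i) UNIV a)" for a
    using no has_root_R_iff[of k n F] Fi by blast
  have start: "doubled_mixture n {i. i < k \<and> face (F i) UNIV \<noteq> {}} (\<lambda>i. face (F i) UNIV) (\<lambda>_. 0)
      (\<lambda>(i, I). if i \<in> {..<k} \<and> I = \<omega> i then 2 else 0) J0"
    using mix unfolding K[unfolded face] face .
  show False
    using macaulay_solution_at_mixture[OF Fi sol none J0 start deg] by (auto simp: face)
qed

section \<open>Prices of variables and monomials\<close>

text \<open>
  One of \<open>m + 1\<close> disjoint intervals contains none of \<open>m\<close> points.
\<close>

lemma geometric_gap:
  fixes q :: real
  assumes q: "0 < q" "q < 1" and Y: "finite Y" "card Y \<le> m"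
  obtains j where "j \<le> m" "\<And>y. y \<in> Y \<Longrightarrow> y \<le> q ^ j \<Longrightarrow> y \<le> q ^ Suc j"
proof (rule ccontr)
  assume "\<not> thesis"
  then have "\<forall>j\<in>{..m}. \<exists>y\<in>Y. y \<le> q ^ j \<and> q ^ Suc j < y" using that by (meson atMost_iff not_le)
  then obtain f where f: "\<And>j. j \<le> m \<Longrightarrow> f j \<in> Y \<and> f j \<le> q ^ j \<and> q ^ Suc j < f j"
    by (metis atMost_iff)
  have less: "f j' < f j" if "j < j'" "j' \<le> m" for j j'
  proof -
    have "f j' \<le> q ^ j'" using f that by blast
    also have "\<dots> \<le> q ^ Suc j" using q that by (intro power_decreasing) auto
    also have "\<dots> < f j" using f that by simp
    finally show ?thesis .
  qed
  have "inj_on f {..m}"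
  proof (rule inj_onI)
    fix j j' assume "j \<in> {..m}" "j' \<in> {..m}" "f j = f j'"
    then show "j = j'" using less[of j j'] less[of j' j] by (cases j j' rule: linorder_cases) auto
  qed
  then have "card {..m} \<le> card Y" using f Y by (intro card_inj_on_le[of f]) auto
  then show False using Y(2) by simp
qed

lemma slope_le_mdeg:
  assumes "\<And>w. w < n \<Longrightarrow> I w \<noteq> 0 \<Longrightarrow> p w \<le> t"
  shows "slope n p I \<le> t * real (mdeg n I)"
proof -
  have "p w * real (I w) \<le> t * real (I w)" if "w < n" for w
    using assms[OF that] by (cases "I w = 0") (auto intro: mult_right_mono)
  then show ?thesis by (auto simp: slope_def mdeg_def sum_distrib_left intro!: sum_mono)
qed

text \<open>
  Given a price for every variable, there is a threshold \<open>\<theta>\<close> such that every polynomial with a monomial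
  all of whose variables cost at most \<open>2 \<theta>\<close> has a monomial that costs at most \<open>\<theta>\<close> in total. The threshold
  sits in a gap of ratio \<open>2 d\<close> among \<open>n\<close> or \<open>k\<close> numbers, whichever is fewer, and this is the origin of
  the exponent \<open>min n k\<close>: the gap is sought among the prices of the \<open>n\<close> variables (a monomial consists
  of at most \<open>d\<close> of them), or among the prices of the cheapest monomials of the \<open>k\<close> polynomials (a monomial
  in variables of price at most \<open>2 \<theta>\<close> costs at most \<open>2 d \<theta>\<close>).
\<close>

lemma price_gap:
  fixes p :: "nat \<Rightarrow> real"
  assumes S: "\<And>i. i < k \<Longrightarrow> finite (S i)" "\<And>i. i < k \<Longrightarrow> S i \<subseteq> exponents n"
    and d: "\<And>i I. i < k \<Longrightarrow> I \<in> S i \<Longrightarrow> mdeg n I \<le> d" "1 \<le> d"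
  obtains \<theta> where "\<theta> \<le> 1 / 2" "(1 / (2 * real d)) ^ Suc (min n k) \<le> \<theta>"
    "\<And>i w. i < k \<Longrightarrow> w \<in> S i \<Longrightarrow> (\<And>v. w v \<noteq> 0 \<Longrightarrow> p v \<le> 2 * \<theta>) \<Longrightarrow> \<exists>w\<in>S i. slope n p w \<le> \<theta>"
proof -
  define q where "q = 1 / (2 * real d)"
  have q: "0 < q" "q < 1" "2 * real d * q = 1" "q \<le> 1/2" using d(2) by (auto simp: q_def field_simps)
  consider "n \<le> k" | "k \<le> n" by linarith
  then show ?thesis
  proof cases
    case 1
    have "card (p ` {..<n}) \<le> n" using card_image_le[of "{..<n}" p] by simp
    from geometric_gap[OF q(1,2) finite_imageI[OF finite_lessThan] this]
    obtain j where "j \<le> n" "\<And>y. y \<in> p ` {..<n} \<Longrightarrow> y \<le> q ^ j \<Longrightarrow> y \<le> q ^ Suc j" by blast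
    then have j: "j \<le> n"
      "\<And>v. v < n \<Longrightarrow> p v \<le> q ^ j \<Longrightarrow> p v \<le> q ^ Suc j" by auto
    define \<theta> where "\<theta> = real d * q ^ Suc j"
    have \<theta>2: "2 * \<theta> = q ^ j" using q(3) by (simp add: \<theta>_def)
    show ?thesis
    proof (rule that[of \<theta>])
      have "q ^ j \<le> 1" using q by (simp add: power_le_one)
      then show "\<theta> \<le> 1 / 2" using \<theta>2 by simp
      have "q ^ Suc (min n k) \<le> q ^ Suc j" using q j 1 by (intro power_decreasing) auto
      also have "\<dots> \<le> real d * q ^ Suc j" using d(2) q by simp
      finally show "(1 / (2 * real d)) ^ Suc (min n k) \<le> \<theta>" by (simp only: \<theta>_def q_def)
      fix i w assume w: "i < k" "w \<in> S i" "\<And>v. w v \<noteq> 0 \<Longrightarrow> p v \<le> 2 * \<theta>"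
      have "slope n p w \<le> q ^ Suc j * real (mdeg n w)"
        by (rule slope_le_mdeg) (use w(3) j(2) \<theta>2 in auto)
      also have "\<dots> \<le> q ^ Suc j * real d"
        using d(1)[OF w(1,2)] q by (intro mult_left_mono) auto
      finally show "\<exists>w\<in>S i. slope n p w \<le> \<theta>" using w(2) by (auto simp: \<theta>_def mult_ac)
    qed
  next
    case 2
    define \<pi> where "\<pi> i = Min (slope n p ` S i)" for i
    have "card (\<pi> ` {..<k}) \<le> k" using card_image_le[of "{..<k}" \<pi>] by simp
    from geometric_gap[OF q(1,2) finite_imageI[OF finite_lessThan] this]
    obtain j where "j \<le> k" "\<And>y. y \<in> \<pi> ` {..<k} \<Longrightarrow> y \<le> q ^ j \<Longrightarrow> y \<le> q ^ Suc j" by blast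
    then have j: "j \<le> k"
      "\<And>i. i < k \<Longrightarrow> \<pi> i \<le> q ^ j \<Longrightarrow> \<pi> i \<le> q ^ Suc j" by auto
    show ?thesis
    proof (rule that[of "q ^ Suc j"])
      have "q ^ j \<le> 1" using q by (simp add: power_le_one)
      then have "q * q ^ j \<le> q" using q by (simp add: mult_le_cancel_left2)
      then show "q ^ Suc j \<le> 1 / 2" using q(4) unfolding power_Suc by linarith
      have "q ^ Suc (min n k) \<le> q ^ Suc j" using q j 2 by (intro power_decreasing) auto
      then show "(1 / (2 * real d)) ^ Suc (min n k) \<le> q ^ Suc j" by (simp only: q_def)
      fix i w assume w: "i < k" "w \<in> S i" "\<And>v. w v \<noteq> 0 \<Longrightarrow> p v \<le> 2 * q ^ Suc j"
      have "\<pi> i \<le> slope n p w" unfolding \<pi>_def using S(1)[OF w(1)] w(2) by (intro Min_le) auto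
      also have "\<dots> \<le> 2 * q ^ Suc j * real (mdeg n w)"
        by (rule slope_le_mdeg) (use w(3) in auto)
      also have "\<dots> \<le> 2 * q ^ Suc j * real d"
        using d(1)[OF w(1,2)] q by (intro mult_left_mono) auto
      also have "\<dots> = q ^ j" using q(3) by (simp add: algebra_simps)
      finally have "\<pi> i \<le> q ^ Suc j" using j(2) w(1) by blast
      moreover have "\<pi> i \<in> slope n p ` S i"
        unfolding \<pi>_def using S(1)[OF w(1)] w(2) by (intro Min_in) auto
      ultimately show "\<exists>w\<in>S i. slope n p w \<le> q ^ Suc j" by auto
    qed
  qed
qed

lemma exp_le_quadratic:
  fixes x :: real
  assumes "\<bar>x\<bar> \<le> 1"
  shows "exp x \<le> 1 + x + x\<^sup>2"
proof (cases "0 \<le> x")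
  case True
  then show ?thesis using assms exp_bound by simp
next
  case False
  have "1 \<le> (1 + x + x\<^sup>2) * (1 - x)"
  proof -
    have "x ^ 3 \<le> 0" using False by (simp add: power3_eq_cube mult_nonneg_nonpos mult_nonpos_nonpos mult_le_0_iff zero_le_mult_iff)
    moreover have "(1 + x + x\<^sup>2) * (1 - x) = 1 - x ^ 3" by (simp add: algebra_simps power2_eq_square power3_eq_cube)
    ultimately show ?thesis by simp
  qed
  also have "\<dots> \<le> (1 + x + x\<^sup>2) * exp (- x)"
  proof (rule mult_left_mono)
    show "1 - x \<le> exp (- x)" using exp_ge_add_one_self[of "- x"] by simp
    have "0 \<le> 1 + x" using assms by linarith
    then show "0 \<le> 1 + x + x\<^sup>2" by simp
  qed
  finally show ?thesis by (simp add: exp_minus field_simps)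
qed

section \<open>Climbing the potential\<close>

text \<open>
  A bounded, concave, separable function. Its derivative in direction \<open>v\<close>, the price of variable \<open>v\<close>,
  is \<open>exp (- J v / L)\<close>: it decays from \<open>1\<close> so fast that a coordinate of size polynomial in \<open>n\<close>, \<open>k\<close>, \<open>d\<close>
  is already cheap, and so slowly that a bounded step hardly changes it.
\<close>

definition potential :: "nat \<Rightarrow> real \<Rightarrow> expo \<Rightarrow> real" where
  "potential n L J = (\<Sum>v<n. L * (1 - exp (- real (J v) / L)))"

lemma potential_gain_coordinate:
  fixes L x x' :: real
  defines "p \<equiv> exp (- x / L)" and "h \<equiv> x' - x"
  assumes L: "0 < L" and h: "\<bar>h\<bar> \<le> L"
  shows "p * (h - h\<^sup>2 / L) \<le> L * (1 - exp (- x' / L)) - L * (1 - p)"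
proof -
  have "exp (- x' / L) = p * exp (- h / L)"
    unfolding p_def h_def by (simp add: exp_add[symmetric] diff_divide_distrib)
  also have "\<dots> \<le> p * (1 + (- h / L) + (- h / L)\<^sup>2)"
    using L h by (intro mult_left_mono exp_le_quadratic) (auto simp: p_def)
  finally have "L * exp (- x' / L) \<le> L * (p * (1 + (- h / L) + (- h / L)\<^sup>2))"
    using L by (intro mult_left_mono) auto
  also have "\<dots> = L * p - p * (h - h\<^sup>2 / L)"
    using L by (simp add: field_simps power2_eq_square)
  finally show ?thesis by (simp add: algebra_simps)
qed

lemma mdeg_coordinate_le: "I \<in> exponents n \<Longrightarrow> I v \<le> mdeg n I"
  unfolding mdeg_def exponents_def
  using member_le_sum[of v "{..<n}" I] by (cases "v < n") auto

text \<open>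
  The support of a Macaulay solution always contains a point of higher potential nearby. Let \<open>p\<close> be the
  prices at \<open>J0\<close>, take \<open>\<theta>\<close> from \<open>price_gap\<close>, and let \<open>U\<close> be the set of variables of price at most \<open>2 \<theta>\<close>.
  Every polynomial with a monomial in \<open>U\<close> has a cheapest such monomial \<open>\<omega> i\<close>, of price at most \<open>\<theta>\<close>. Its
  variables have price at most \<open>1/2\<close>, hence large coordinates in \<open>J0\<close>, so that \<open>J0\<close> arises by mixing the
  \<open>\<omega> i\<close> on top of some \<open>E0 \<ge> 0\<close>. The touching argument passes from \<open>J0\<close> to another mixture \<open>J\<close> and then
  exchanges a monomial \<open>v\<close> for a monomial \<open>I\<close> that leaves \<open>U\<close>. The mixture \<open>J\<close> loses nothing in price,
  since the \<open>\<omega> i\<close> were cheapest, and the removal of \<open>v\<close> costs at most \<open>\<theta>\<close> in all. The gain is at least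
  \<open>2 \<theta>\<close>, from a variable outside \<open>U\<close>. The difference is large compared with the second order error.
\<close>

lemma potential_step:
  assumes F: "\<And>i. i < k \<Longrightarrow> tpoly_Rinf n (F i)" and k: "1 \<le> k"
    and d: "1 \<le> d" "\<And>i. i < k \<Longrightarrow> tdegree n (F i) \<le> d"
    and B: "B = 3 * k * d" and L: "L = 8 * real (n + 1) * (real B)\<^sup>2"
    and sol: "macaulay_solution n k F N D y"
    and no_root: "\<And>U a. \<not> (\<forall>i<k. no_strict_minimum n (F i) U a)"
    and J0: "J0 \<in> D" "mdeg n J0 + B \<le> N"
  shows "\<exists>J\<in>D. mdeg n J \<le> mdeg n J0 + B \<and>
    potential n L J0 + (1 / (2 * real d)) ^ Suc (min n k) / 2 \<le> potential n L J"
proof -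
  have deg: "mdeg n I \<le> d" if "i < k" "I \<in> monomials (F i)" for i I
    using mdeg_le_tdegree[OF F[OF that(1)] that(2)] d(2)[OF that(1)] by linarith
  have coord: "I v \<le> d" if "i < k" "I \<in> monomials (F i)" for i I v
    using mdeg_coordinate_le[OF tpoly_exponents[OF F[OF that(1)] that(2)], of v] deg[OF that] by linarith
  have "1 * 1 \<le> k * d" using k d by (intro mult_mono) auto
  then have B3: "3 \<le> B" "d \<le> B" "2 * (k * d) + d \<le> B" using k by (auto simp: B)
  have LB: "8 * real B \<le> L"
  proof -
    have "real B * 1 \<le> real B * real B" using B3 by (intro mult_left_mono) auto
    then have "8 * real B \<le> 8 * 1 * (real B)\<^sup>2" by (simp add: power2_eq_square)
    also have "\<dots> \<le> L" unfolding L by (intro mult_right_mono mult_left_mono) auto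
    finally show ?thesis .
  qed
  have L0: "0 < L" using LB B3 by linarith
  define p where "p v = exp (- real (J0 v) / L)" for v
  have p0: "0 < p v" for v by (simp add: p_def)
  have subM: "monomials (F i) \<subseteq> exponents n" if "i < k" for i using tpoly_exponents[OF F[OF that]] by blast
  obtain \<theta> where \<theta>: "\<theta> \<le> 1 / 2" "(1 / (2 * real d)) ^ Suc (min n k) \<le> \<theta>"
    and cheap: "\<And>i w. i < k \<Longrightarrow> w \<in> monomials (F i) \<Longrightarrow> (\<And>v. w v \<noteq> 0 \<Longrightarrow> p v \<le> 2 * \<theta>) \<Longrightarrow>
      \<exists>w\<in>monomials (F i). slope n p w \<le> \<theta>"
    by (rule price_gap[where S = "\<lambda>i. monomials (F i)" and p = p and k = k, OF tpoly_finite[OF F] subM deg d(1)];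
        (assumption | (rule that; blast)))
  have \<theta>0: "0 < \<theta>" using \<theta>(2) d(1) by (intro less_le_trans[OF _ \<theta>(2)]) simp
  define U where "U = {v. p v \<le> 2 * \<theta>}"
  let ?K = "{i. i < k \<and> face (F i) U \<noteq> {}}" and ?S = "\<lambda>i. face (F i) U"
  have sub: "?S i \<subseteq> monomials (F i)" for i by (auto simp: face_def)
  have finK: "finite ?K" by simp
  have finS: "finite (?S i)" if "i \<in> ?K" for i
    using tpoly_finite[OF F, of i] sub finite_subset that by blast
  have price: "p v \<le> slope n p w" if w: "i < k" "w \<in> monomials (F i)" "w v \<noteq> 0" for i v w
  proof -
    have "v < n" using exponents_support[OF tpoly_exponents[OF F[OF w(1)] w(2)] w(3)] .
    then have "p v * real (w v) \<le> slope n p w"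
      unfolding slope_def by (intro member_le_sum mult_nonneg_nonneg less_imp_le[OF p0]) auto
    moreover have "p v * 1 \<le> p v * real (w v)" using w(3) p0[of v] by (intro mult_left_mono) auto
    ultimately show ?thesis by simp
  qed
  have "\<exists>w\<in>?S i. slope n p w \<le> \<theta> \<and> (\<forall>I\<in>?S i. slope n p w \<le> slope n p I)" if active: "i \<in> ?K" for i
  proof -
    from active obtain I where "i < k" "I \<in> monomials (F i)" "\<And>v. I v \<noteq> 0 \<Longrightarrow> p v \<le> 2 * \<theta>"
      unfolding face_def U_def by blast
    then obtain w where w: "w \<in> monomials (F i)" "slope n p w \<le> \<theta>"
      using cheap[of i I] by blast
    have "p v \<le> 2 * \<theta>" if "w v \<noteq> 0" for v
      using price[OF \<open>i < k\<close> w(1) that] w(2) \<theta>0 by linarith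
    then have "w \<in> ?S i" using w(1) unfolding face_def U_def by blast
    have "Min (slope n p ` ?S i) \<in> slope n p ` ?S i" using finS[OF active] active by (intro Min_in) auto
    then obtain w' where w': "w' \<in> ?S i" "\<And>I. I \<in> ?S i \<Longrightarrow> slope n p w' \<le> slope n p I"
      using finS[OF active] by (smt (verit) Min_le finite_imageI imageE imageI)
    moreover have "slope n p w' \<le> \<theta>" using w'(2)[OF \<open>w \<in> ?S i\<close>] w(2) by linarith
    ultimately show ?thesis by blast
  qed
  then have "\<forall>i\<in>?K. \<exists>w. w \<in> ?S i \<and> slope n p w \<le> \<theta> \<and> (\<forall>I\<in>?S i. slope n p w \<le> slope n p I)" by blast
  from bchoice[OF this] obtain \<omega> where
    "\<forall>i\<in>?K. \<omega> i \<in> ?S i \<and> slope n p (\<omega> i) \<le> \<theta> \<and> (\<forall>I\<in>?S i. slope n p (\<omega> i) \<le> slope n p I)" ..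
  then have \<omega>: "\<And>i. i \<in> ?K \<Longrightarrow> \<omega> i \<in> ?S i" "\<And>i. i \<in> ?K \<Longrightarrow> slope n p (\<omega> i) \<le> \<theta>"
    "\<And>i I. i \<in> ?K \<Longrightarrow> I \<in> ?S i \<Longrightarrow> slope n p (\<omega> i) \<le> slope n p I" by blast+
  have "card ?K \<le> k" using card_mono[of "{..<k}" ?K] by auto
  then have Kd: "(\<Sum>i\<in>?K. d) \<le> k * d" by simp
  \<comment> \<open>A coordinate used by some \<open>\<omega> i\<close> has price at most \<open>1/2\<close>, so it is at least \<open>L/2\<close>.\<close>
  have \<omega>J0: "2 * (\<Sum>i\<in>?K. \<omega> i v) \<le> J0 v" for v
  proof (cases "\<exists>i\<in>?K. \<omega> i v \<noteq> 0")
    case True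
    then obtain i where i: "i \<in> ?K" "\<omega> i v \<noteq> 0" by blast
    then have "p v \<le> 1 / 2" using price[of i "\<omega> i" v] \<omega>(1,2)[OF i(1)] \<theta>(1) sub by force
    then have "1 - real (J0 v) / L \<le> 1 / 2"
      using exp_ge_add_one_self[of "- real (J0 v) / L"] by (simp add: p_def)
    then have "4 * real B \<le> real (J0 v)" using LB L0 by (simp add: field_simps)
    moreover have "(\<Sum>i\<in>?K. \<omega> i v) \<le> (\<Sum>i\<in>?K. d)" using \<omega>(1) sub coord by (intro sum_mono) blast
    ultimately show ?thesis using Kd B3 by linarith
  next
    case False
    then have "(\<Sum>i\<in>?K. \<omega> i v) = 0" by (intro sum.neutral) blast
    then show ?thesis by simp
  qed
  define E0 where "E0 v = J0 v - 2 * (\<Sum>i\<in>?K. \<omega> i v)" for v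
  have J0E0: "J0 w = E0 w + 2 * (\<Sum>i\<in>?K. \<omega> i w)" for w using \<omega>J0 by (simp add: E0_def)
  have start: "doubled_mixture n ?K ?S E0 (\<lambda>(i, I). if i \<in> ?K \<and> I = \<omega> i then 2 else 0) J0"
    by (rule mixture_of_choice[OF finK finS \<omega>(1)]) (use J0E0 in auto)
  have E0_le: "mdeg n E0 \<le> mdeg n J0" unfolding mdeg_def by (intro sum_mono) (simp add: E0_def)
  have degs: "(\<Sum>i<k. tdegree n (F i)) \<le> k * d"
    using sum_bounded_above[of "{..<k}" "\<lambda>i. tdegree n (F i)" d] d(2) by simp
  have degN: "mdeg n E0 + 2 * (\<Sum>i<k. tdegree n (F i)) + tdegree n (F i) \<le> N" if "i < k" for i
    using E0_le degs d(2)[OF that] J0(2) B3 by linarith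
  have "\<exists>i v J \<mu> I. i < k \<and> v \<in> ?S i \<and> J \<in> D \<and> doubled_mixture n ?K ?S E0 \<mu> J \<and> \<mu> (i, v) = 2 \<and>
    (\<forall>w. v w \<le> J w) \<and> I \<in> monomials (F i) \<and> I \<notin> ?S i \<and> shift (\<lambda>w. J w - v w) I \<in> D"
    by (rule macaulay_solution_at_mixture[OF F sol no_root J0(1) start degN])
  then obtain i v J \<mu> I where i: "i < k" "v \<in> ?S i"
    and J: "J \<in> D" "doubled_mixture n ?K ?S E0 \<mu> J" "\<mu> (i, v) = 2"
    and vJ': "\<forall>w. v w \<le> J w"
    and I: "I \<in> monomials (F i)" "I \<notin> ?S i" "shift (\<lambda>w. J w - v w) I \<in> D"
    by (elim exE conjE) (rule that)
  have vJ: "v w \<le> J w" for w using vJ' by blast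
  define J' where "J' = shift (\<lambda>w. J w - v w) I"
  have iK: "i \<in> ?K" using i by auto
  have vm: "v \<in> monomials (F i)" using i sub by auto
  have J'w: "real (J' w) = real (J w) - real (v w) + real (I w)" for w
    using vJ[of w] by (simp add: J'_def shift_def of_nat_diff)
  have mixw: "real (E0 w) \<le> real (J w)" "real (J w) \<le> real (E0 w) + 2 * real (k * d)" if "w < n" for w
  proof -
    have eq: "real (J w) = real (E0 w) + (\<Sum>x\<in>Sigma ?K ?S. \<mu> x * real (snd x w))"
      using J(2) that by (simp add: doubled_mixture_def)
    have "0 \<le> \<mu> x" for x using J(2) by (cases x) (simp add: doubled_mixture_def)
    then show "real (E0 w) \<le> real (J w)" using eq by (simp add: sum_nonneg)
    have "(\<Sum>x\<in>Sigma ?K ?S. \<mu> x * real (snd x w)) \<le> 2 * (\<Sum>i\<in>?K. real d)"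
    proof (rule mixture_sum_le[OF finK finS J(2)])
      fix i I assume "i \<in> ?K" "I \<in> ?S i"
      then have "I w \<le> d" using coord sub by blast
      then show "real (snd (i, I) w) \<le> real d" by simp
    qed
    also have "(\<Sum>i\<in>?K. real d) \<le> real (k * d)"
      using of_nat_mono[OF Kd, where 'a = real] by (simp only: of_nat_sum)
    finally show "real (J w) \<le> real (E0 w) + 2 * real (k * d)" using eq by simp
  qed
  have J0w: "real (E0 w) \<le> real (J0 w)" "real (J0 w) \<le> real (E0 w) + 2 * real (k * d)" for w
  proof -
    show "real (E0 w) \<le> real (J0 w)" by (simp add: E0_def)
    have "(\<Sum>i\<in>?K. \<omega> i w) \<le> (\<Sum>i\<in>?K. d)" using \<omega>(1) sub coord by (intro sum_mono) blast
    then have "J0 w \<le> E0 w + 2 * (k * d)" using Kd J0E0[of w] by linarith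
    then show "real (J0 w) \<le> real (E0 w) + 2 * real (k * d)" by linarith
  qed
  \<comment> \<open>The step is \<open>r + I\<close>; outside \<open>U\<close> only \<open>I\<close> moves, because the mixtures stay in the face.\<close>
  define r where "r w = real (J w) - real (v w) - real (J0 w)" for w
  have r_outside: "r w = 0" if "w < n" "w \<notin> U" for w
  proof -
    have z: "K w = 0" if "K \<in> ?S j" for K j using that \<open>w \<notin> U\<close> by (auto simp: face_def)
    have "(\<Sum>x\<in>Sigma ?K ?S. \<mu> x * real (snd x w)) = 0" by (intro sum.neutral) (auto simp: z)
    then have "real (J w) = real (E0 w)" using J(2) that by (simp add: doubled_mixture_def)
    moreover have "J0 w = E0 w" using z[OF \<omega>(1)] by (simp add: J0E0[of w])
    ultimately show ?thesis using z[OF i(2)] by (simp add: r_def)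
  qed
  have price_r: "- \<theta> \<le> (\<Sum>w<n. p w * r w)"
  proof -
    let ?\<phi> = "\<lambda>x. slope n p (snd x) - slope n p (\<omega> (fst x))"
    have \<mu>0: "0 \<le> \<mu> x" for x using J(2) by (cases x) (simp add: doubled_mixture_def)
    define A where "A = (\<Sum>x\<in>Sigma ?K ?S. \<mu> x * slope n p (snd x))"
    define W where "W = (\<Sum>i\<in>?K. slope n p (\<omega> i))"
    define Q where "Q = (\<Sum>x\<in>Sigma ?K ?S. \<mu> x * ?\<phi> x)"
    define PR where "PR = (\<Sum>w<n. p w * r w)"
    have "PR = slope n p J - slope n p v - slope n p J0"
      by (simp add: PR_def r_def slope_def algebra_simps sum_subtractf sum.distrib)
    moreover have "slope n p J = slope n p E0 + A"
      unfolding A_def by (rule mixture_slope[OF J(2)])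
    moreover have "slope n p J0 = slope n p E0 + 2 * W"
    proof -
      have "slope n p J0 = slope n p E0 + (\<Sum>w<n. \<Sum>i\<in>?K. 2 * (p w * real (\<omega> i w)))"
        unfolding slope_def sum.distrib[symmetric]
        by (intro sum.cong) (auto simp: J0E0 algebra_simps sum_distrib_left)
      also have "(\<Sum>w<n. \<Sum>i\<in>?K. 2 * (p w * real (\<omega> i w))) = 2 * W"
        unfolding W_def by (subst sum.swap) (simp add: slope_def sum_distrib_left)
      finally show ?thesis .
    qed
    moreover have "Q = A - 2 * W"
    proof -
      have "(\<Sum>x\<in>Sigma ?K ?S. \<mu> x * slope n p (\<omega> (fst x)))
          = (\<Sum>i\<in>?K. (\<Sum>I\<in>?S i. \<mu> (i, I)) * slope n p (\<omega> i))"
        by (subst sum_pairs[OF finK finS]) (simp_all add: sum_distrib_right)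
      also have "\<dots> = (\<Sum>i\<in>?K. 2 * slope n p (\<omega> i))"
        using J(2) by (intro sum.cong) (auto simp: doubled_mixture_def)
      finally show ?thesis
        by (simp add: Q_def A_def W_def right_diff_distrib sum_subtractf sum_distrib_left)
    qed
    moreover have "2 * (slope n p v - slope n p (\<omega> i)) \<le> Q"
    proof -
      have "\<mu> (i, v) * ?\<phi> (i, v) \<le> Q"
        unfolding Q_def
      proof (rule member_le_sum)
        show "(i, v) \<in> Sigma ?K ?S" using iK i(2) by blast
        show "finite (Sigma ?K ?S)" using finK finS by blast
        show "0 \<le> \<mu> x * ?\<phi> x" if "x \<in> Sigma ?K ?S - {(i, v)}" for x
        proof -
          obtain j I where "x = (j, I)" "j \<in> ?K" "I \<in> ?S j" using \<open>x \<in> _\<close> by blast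
          then show ?thesis using \<mu>0[of x] \<omega>(3)[of j I] by simp
        qed
      qed
      then show ?thesis using J(3) by simp
    qed
    moreover have "slope n p (\<omega> i) \<le> slope n p v" "slope n p (\<omega> i) \<le> \<theta>" using \<omega>(2,3) iK i(2) by auto
    ultimately have "- slope n p (\<omega> i) \<le> PR" "slope n p (\<omega> i) \<le> \<theta>" by simp_all
    then have "- \<theta> \<le> PR" by linarith
    then show ?thesis by (simp add: PR_def)
  qed
  \<comment> \<open>The new monomial uses a variable outside \<open>U\<close>, whose price exceeds \<open>2 \<theta>\<close>.\<close>
  obtain w0 where "I w0 \<noteq> 0" "w0 \<notin> U" using I by (auto simp: face_def)
  moreover have "w0 < n"
    using exponents_support[OF tpoly_exponents[OF F[OF i(1)] I(1)] \<open>I w0 \<noteq> 0\<close>] .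
  ultimately have "1 \<le> (if w0 \<in> U then 0 else real (I w0))" by simp
  also have "\<dots> \<le> (\<Sum>w<n. if w \<in> U then 0 else real (I w))"
    using \<open>w0 < n\<close> by (intro member_le_sum) auto
  finally have out: "1 \<le> (\<Sum>w<n. if w \<in> U then 0 else real (I w))" .
  have gain: "p w * r w - \<theta> / (4 * real (n + 1)) + 7 / 4 * \<theta> * (if w \<in> U then 0 else real (I w))
      \<le> L * (1 - exp (- real (J' w) / L)) - L * (1 - exp (- real (J0 w) / L))" if w: "w < n" for w
  proof -
    define h where "h = real (J' w) - real (J0 w)"
    have hr: "h = r w + real (I w)" by (simp add: h_def r_def J'w)
    have Id: "real (I w) \<le> real d" "real (v w) \<le> real d" using coord[OF i(1)] I(1) vm by auto
    have hB: "\<bar>h\<bar> \<le> real B"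
    proof -
      have "2 * real (k * d) + real d \<le> real B" using B3(3) by linarith
      then show ?thesis using mixw[OF w] J0w[of w] Id unfolding h_def J'w by linarith
    qed
    then have hL: "\<bar>h\<bar> \<le> L" using LB by linarith
    have g: "p w * (h - h\<^sup>2 / L) \<le> L * (1 - exp (- real (J' w) / L)) - L * (1 - exp (- real (J0 w) / L))"
      using potential_gain_coordinate[OF L0, of "real (J' w)" "real (J0 w)"] hL by (simp add: h_def p_def)
    show ?thesis
    proof (cases "w \<in> U")
      case True
      have "h\<^sup>2 \<le> (real B)\<^sup>2" using hB by (simp add: abs_le_square_iff[symmetric])
      then have "h\<^sup>2 / L \<le> (real B)\<^sup>2 / L" using L0 by (simp add: divide_right_mono)
      also have "\<dots> = 1 / (8 * real (n + 1))"
      proof -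
        have "(real B)\<^sup>2 \<noteq> 0" using B3 by simp
        from mult_divide_mult_cancel_right[OF this, of 1 "8 * real (n + 1)"] show ?thesis
          unfolding L by (simp only: mult_1)
      qed
      finally have "p w * (h\<^sup>2 / L) \<le> (2 * \<theta>) * (1 / (8 * real (n + 1)))"
        using True p0[of w] L0 by (intro mult_mono) (auto simp: U_def)
      moreover have "p w * r w \<le> p w * h" using p0[of w] by (simp add: hr)
      moreover have "(2 * \<theta>) * (1 / (8 * real (n + 1))) = \<theta> / (4 * real (n + 1))" by (simp add: field_simps)
      ultimately show ?thesis using g True by (simp add: right_diff_distrib)
    next
      case False
      have hI: "h = real (I w)" using hr r_outside[OF w False] by simp
      have "8 * h \<le> L" using Id hI B3 LB by linarith
      then have "h / L \<le> 1 / 8" using L0 by (simp add: field_simps)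
      then have "h * (h / L) \<le> h * (1 / 8)" using hI by (intro mult_left_mono) auto
      then have "7 / 8 * h \<le> h - h\<^sup>2 / L" by (simp add: power2_eq_square)
      then have "(2 * \<theta>) * (7 / 8 * h) \<le> p w * (h - h\<^sup>2 / L)"
        using False \<theta>0 hI by (intro mult_mono) (auto simp: U_def)
      moreover have "0 \<le> \<theta> / (4 * real (n + 1))" using \<theta>0 by simp
      moreover have "(2 * \<theta>) * (7 / 8 * h) = 7 / 4 * \<theta> * (if w \<in> U then 0 else real (I w))"
        using False hI by simp
      moreover have "p w * r w = 0" using r_outside[OF w False] by simp
      ultimately show ?thesis using g by linarith
    qed
  qed
  have "(\<Sum>w<n. p w * r w - \<theta> / (4 * real (n + 1)) + 7 / 4 * \<theta> * (if w \<in> U then 0 else real (I w)))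
      \<le> (\<Sum>w<n. L * (1 - exp (- real (J' w) / L)) - L * (1 - exp (- real (J0 w) / L)))"
    by (intro sum_mono gain) auto
  also have "\<dots> = potential n L J' - potential n L J0" by (simp add: potential_def sum_subtractf)
  also have "(\<Sum>w<n. p w * r w - \<theta> / (4 * real (n + 1)) + 7 / 4 * \<theta> * (if w \<in> U then 0 else real (I w)))
      = (\<Sum>w<n. p w * r w) - real n * (\<theta> / (4 * real (n + 1)))
        + 7 / 4 * \<theta> * (\<Sum>w<n. if w \<in> U then 0 else real (I w))"
    by (simp add: sum.distrib sum_subtractf sum_distrib_left)
  finally have total: "(\<Sum>w<n. p w * r w) - real n * (\<theta> / (4 * real (n + 1)))
        + 7 / 4 * \<theta> * (\<Sum>w<n. if w \<in> U then 0 else real (I w)) \<le> potential n L J' - potential n L J0" .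
  have "real n * (\<theta> / (4 * real (n + 1))) \<le> \<theta> / 4" using \<theta>0 by (simp add: field_simps)
  moreover have "7 / 4 * \<theta> * 1 \<le> 7 / 4 * \<theta> * (\<Sum>w<n. if w \<in> U then 0 else real (I w))"
    using out \<theta>0 by (intro mult_left_mono) auto
  ultimately have "\<theta> / 2 \<le> potential n L J' - potential n L J0"
    using total price_r by linarith
  then have "potential n L J0 + (1 / (2 * real d)) ^ Suc (min n k) / 2 \<le> potential n L J'"
    using \<theta>(2) by linarith
  moreover have "mdeg n J' \<le> mdeg n J0 + B"
  proof -
    have "mdeg n J \<le> mdeg n E0 + 2 * (\<Sum>i\<in>?K. d)"
      by (rule mixture_mdeg_le[OF finK finS J(2)]) (use deg sub in auto)
    moreover have "mdeg n (\<lambda>w. J w - v w) \<le> mdeg n J" unfolding mdeg_def by (intro sum_mono) auto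
    ultimately show ?thesis
      using deg[OF i(1) I(1)] E0_le Kd B3 unfolding J'_def mdeg_shift by linarith
  qed
  ultimately show ?thesis using I(3) unfolding J'_def by blast
qed

section \<open>The effective Nullstellensatz\<close>

text \<open>
  The number of steps after which the potential would exceed its bound, times the degree of a step.
\<close>

definition macaulay_bound :: "nat \<Rightarrow> nat \<Rightarrow> nat \<Rightarrow> nat" where
  "macaulay_bound n k d =
     (let B = 3 * k * d in (16 * n * (n + 1) * B ^ 2 * (2 * d) ^ Suc (min n k) + 1) * B)"

lemma potential_le:
  assumes "0 < L"
  shows "potential n L J \<le> real n * L"
proof -
  have "(\<Sum>v<n. L * (1 - exp (- real (J v) / L))) \<le> (\<Sum>v<n. L)"
    using assms by (intro sum_mono) (simp add: mult_le_cancel_left1)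
  then show ?thesis by (simp add: potential_def)
qed

text \<open>
  Start at the constant monomial and apply \<open>potential_step\<close>. Every step raises the potential by the fixed
  amount \<open>\<delta>\<close> and the degree by at most \<open>B\<close>, while the potential is bounded by \<open>n L\<close>; so without a root
  the degree bound would admit too many steps.
\<close>

theorem macaulay_root_Rinf:
  assumes F: "\<And>i. i < k \<Longrightarrow> tpoly_Rinf n (F i)"
    and d: "\<And>i. i < k \<Longrightarrow> tdegree n (F i) \<le> d"
    and sol: "macaulay_solution n k F (macaulay_bound n k d) D y" and zero: "(\<lambda>_. 0) \<in> D"
  shows "has_root_Rinf n k F"
proof (cases "k = 0 \<or> d = 0")
  case True
  \<comment> \<open>In degree zero the row of a nonzero constant contradicts the finite entry at the constant monomial.\<close>
  have "no_strict_minimum n (F i) U a" if "i < k" for i U a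
  proof -
    have "d = 0" using True that by auto
    have z: "I = (\<lambda>_. 0)" if "I \<in> monomials (F i)" for I
    proof
      fix v
      have "mdeg n I = 0" using mdeg_le_tdegree[OF F[OF \<open>i < k\<close>] that] d[OF \<open>i < k\<close>] \<open>d = 0\<close> by simp
      then show "I v = 0" using mdeg_coordinate_le[OF tpoly_exponents[OF F[OF \<open>i < k\<close>] that], of v] by simp
    qed
    have "monomials (F i) = {}"
    proof (rule ccontr)
      assume "monomials (F i) \<noteq> {}"
      then have "(\<lambda>_. 0) \<in> monomials (F i)" using z by (metis ex_in_conv)
      moreover have "(\<lambda>_. 0) \<in> exponents n" "mdeg n (\<lambda>_. 0) + tdegree n (F i) \<le> macaulay_bound n k d"
        "shift (\<lambda>_. 0) (\<lambda>_. 0) \<in> D"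
        using d[OF that] \<open>d = 0\<close> zero by (simp_all add: exponents_def mdeg_def shift_def)
      ultimately have "\<exists>I\<in>monomials (F i). I \<noteq> (\<lambda>_. 0)"
        using sol that unfolding macaulay_solution_def by blast
      then show False using z by blast
    qed
    then show ?thesis by (simp add: no_strict_minimum_def face_def)
  qed
  then show ?thesis using has_root_Rinf_iff[of k n F] F by blast
next
  case False
  then have k: "1 \<le> k" and d1: "1 \<le> d" by auto
  show ?thesis
  proof (rule ccontr)
    assume "\<not> has_root_Rinf n k F"
    then have no_root: "\<not> (\<forall>i<k. no_strict_minimum n (F i) U a)" for U a
      using has_root_Rinf_iff[of k n F] F by blast
    define B where "B = 3 * k * d"
    define L where "L = 8 * real (n + 1) * (real B)\<^sup>2"
    define \<delta> where "\<delta> = (1 / (2 * real d)) ^ Suc (min n k) / 2"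
    define T where "T = 16 * n * (n + 1) * B ^ 2 * (2 * d) ^ Suc (min n k) + 1"
    have N: "macaulay_bound n k d = T * B" by (simp add: macaulay_bound_def T_def B_def Let_def)
    have L0: "0 < L" using k d1 by (simp add: L_def B_def)
    have \<delta>0: "0 < \<delta>" using d1 by (simp add: \<delta>_def)
    have "\<exists>J\<in>D. mdeg n J \<le> t * B \<and> real t * \<delta> \<le> potential n L J" if "t \<le> T" for t
      using that
    proof (induction t)
      case 0
      show ?case using zero by (intro bexI[of _ "\<lambda>_. 0"]) (simp_all add: mdeg_def potential_def)
    next
      case (Suc t)
      then obtain J where J: "J \<in> D" "mdeg n J \<le> t * B" "real t * \<delta> \<le> potential n L J" by auto
      have "mdeg n J + B \<le> Suc t * B" using J(2) by simp
      also have "\<dots> \<le> T * B" using Suc.prems by (intro mult_right_mono) auto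
      finally have fits: "mdeg n J + B \<le> macaulay_bound n k d" by (simp add: N)
      have "\<exists>J'\<in>D. mdeg n J' \<le> mdeg n J + B \<and> potential n L J + \<delta> \<le> potential n L J'"
        unfolding \<delta>_def by (rule potential_step[where F = F and k = k and n = n, OF F k d1 d B_def L_def sol no_root J(1) fits])
      then obtain J' where "J' \<in> D" "mdeg n J' \<le> mdeg n J + B" "potential n L J + \<delta> \<le> potential n L J'"
        by blast
      then show ?case using J by (intro bexI[of _ J']) (auto simp: algebra_simps)
    qed
    then obtain J where "real T * \<delta> \<le> potential n L J" by blast
    also have "\<dots> \<le> real n * L" by (rule potential_le[OF L0])
    also have "real n * L < real T * \<delta>"
    proof -
      have "(2 * real d) ^ Suc (min n k) * (1 / (2 * real d)) ^ Suc (min n k) = 1"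
        by (subst power_mult_distrib[symmetric]) (use d1 in simp)
      then have "(2 * real d) ^ Suc (min n k) * \<delta> = 1 / 2" by (simp add: \<delta>_def del: power_Suc)
      moreover have "real T * \<delta> = 16 * real n * real (n + 1) * (real B)\<^sup>2 * ((2 * real d) ^ Suc (min n k) * \<delta>) + \<delta>"
        by (simp add: T_def algebra_simps del: power_Suc)
      ultimately have "real T * \<delta> = 16 * real n * real (n + 1) * (real B)\<^sup>2 * (1 / 2) + \<delta>"
        by (simp only:)
      then have "real T * \<delta> = real n * L + \<delta>" by (simp add: L_def)
      then show ?thesis using \<delta>0 by simp
    qed
    finally show False by simp
  qed
qed

lemma poly3_add: "poly3 (p + q) x y z = poly3 p x y z + poly3 q x y z"
  and poly3_mult: "poly3 (p * q) x y z = poly3 p x y z * poly3 q x y z"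
  and poly3_one: "poly3 1 x y z = 1"
  and poly3_numeral: "poly3 (numeral m) x y z = numeral m"
  and poly3_power: "poly3 (p ^ e) x y z = poly3 p x y z ^ e"
  by (simp_all add: poly3_def)

lemma poly3_variables:
  "poly3 [:[:[:0, 1:]:]:] x y z = x" "poly3 [:[:0, 1:]:] x y z = y" "poly3 [:0, 1:] x y z = z"
  by (simp_all add: poly3_def)

text \<open>
  One factor \<open>2 d\<close> of the power in the bound goes into the polynomial; the rest is dominated by
  \<open>(4 d) ^ min n k\<close>.
\<close>

lemma macaulay_bound_le:
  "\<exists>p :: real poly poly poly. \<forall>n k d.
    real (macaulay_bound n k d) \<le> poly3 p (real n) (real k) (real d) * (4 * real d) ^ min n k"
proof -
  define X Y Z :: "real poly poly poly" where "X = [:[:[:0, 1:]:]:]" and "Y = [:[:0, 1:]:]" and "Z = [:0, 1:]"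
  define p where "p = (32 * X * (X + 1) * (3 * Y * Z) ^ 2 * Z + 1) * (3 * Y * Z)"
  have p: "poly3 p x y z = (32 * x * (x + 1) * (3 * y * z)\<^sup>2 * z + 1) * (3 * y * z)" for x y z
    unfolding p_def X_def Y_def Z_def
    by (simp only: poly3_add poly3_mult poly3_one poly3_numeral poly3_power poly3_variables)
  show ?thesis
  proof (intro exI[of _ p] allI)
    fix n k d :: nat
    define B c where "B = 3 * real k * real d" and "c = 32 * real n * (real n + 1) * B\<^sup>2 * real d"
    have nonneg: "0 \<le> B" "0 \<le> c" by (auto simp: B_def c_def)
    show "real (macaulay_bound n k d) \<le> poly3 p (real n) (real k) (real d) * (4 * real d) ^ min n k"
    proof (cases "d = 0")
      case False
      have "(2 * real d) ^ min n k \<le> (4 * real d) ^ min n k" by (intro power_mono) auto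
      then have "c * (2 * real d) ^ min n k \<le> c * (4 * real d) ^ min n k" using nonneg by (intro mult_left_mono) auto
      moreover have "1 \<le> (4 * real d) ^ min n k" using False by (intro one_le_power) auto
      ultimately have "c * (2 * real d) ^ min n k + 1 \<le> (c + 1) * (4 * real d) ^ min n k" by (simp add: algebra_simps)
      then have "(c * (2 * real d) ^ min n k + 1) * B \<le> (c + 1) * (4 * real d) ^ min n k * B"
        using nonneg by (intro mult_right_mono) auto
      then show ?thesis
        by (simp add: macaulay_bound_def p Let_def c_def B_def algebra_simps)
    qed (simp add: macaulay_bound_def p)
  qed
qed

theorem nullstellensatz_R:
  assumes F: "\<And>i. i < k \<Longrightarrow> tpoly_R n (F i)"
  shows "\<not> has_root_R n k F \<longleftrightarrow>
    (\<exists>g. nonsingular_combination n k F g \<and> tdegree n g \<le> (n + 2) * (\<Sum>i<k. tdegree n (F i)))"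
proof -
  have Fi: "tpoly_Rinf n (F i)" if "i < k" for i using F[OF that] by (simp add: tpoly_R_def)
  define N where "N = (n + 2) * (\<Sum>i<k. tdegree n (F i))"
  have "\<exists>g. nonsingular_combination n k F g \<and> tdegree n g \<le> N" if no: "\<not> has_root_R n k F"
  proof -
    obtain D y where sol: "macaulay_solution n k F N D y"
      and comb: "{J \<in> exponents n. mdeg n J \<le> N} - D \<noteq> {} \<Longrightarrow>
       \<exists>g. nonsingular_combination n k F g \<and> tdegree n g \<le> N \<and> monomials g = {J \<in> exponents n. mdeg n J \<le> N} - D"
      using macaulay_alternative[of k n F N] Fi by blast
    have "{J \<in> exponents n. mdeg n J \<le> N} - D \<noteq> {}"
    proof
      assume "{J \<in> exponents n. mdeg n J \<le> N} - D = {}"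
      moreover have "D \<subseteq> {J \<in> exponents n. mdeg n J \<le> N}" using sol by (simp add: macaulay_solution_def)
      ultimately have "D = {J \<in> exponents n. mdeg n J \<le> N}" by blast
      then show False using macaulay_root_R[OF F _ N_def] sol no by blast
    qed
    from comb[OF this] show ?thesis by blast
  qed
  moreover have "\<not> has_root_R n k F" if g: "nonsingular_combination n k F g" for g
  proof
    assume "has_root_R n k F"
    then obtain a where "\<And>i. i < k \<Longrightarrow> no_strict_minimum n (F i) UNIV a" using has_root_R_iff[of k n F] Fi by blast
    moreover have "face g UNIV \<noteq> {}"
      using nonsingular_combination_nonempty[OF F g] by (simp add: face_def)
    ultimately show False using nonsingular_combination_excludes_root[OF Fi g] by blast
  qed
  ultimately show ?thesis unfolding N_def by blast
qed

theorem nullstellensatz_Rinf: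
  assumes F: "\<And>i. i < k \<Longrightarrow> tpoly_Rinf n (F i)" and d: "\<And>i. i < k \<Longrightarrow> tdegree n (F i) \<le> d"
    and N: "real (macaulay_bound n k d) \<le> N"
  shows "\<not> has_root_Rinf n k F \<longleftrightarrow>
    (\<exists>g. nonsingular_combination n k F g \<and> real (tdegree n g) \<le> N \<and> g (\<lambda>v. 0) \<noteq> \<infinity>)"
proof
  let ?M = "macaulay_bound n k d"
  assume no: "\<not> has_root_Rinf n k F"
  obtain D y where sol: "macaulay_solution n k F ?M D y"
    and comb: "{J \<in> exponents n. mdeg n J \<le> ?M} - D \<noteq> {} \<Longrightarrow>
     \<exists>g. nonsingular_combination n k F g \<and> tdegree n g \<le> ?M \<and> monomials g = {J \<in> exponents n. mdeg n J \<le> ?M} - D"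
    using macaulay_alternative[of k n F ?M] F by blast
  have "(\<lambda>_. 0) \<notin> D" using macaulay_root_Rinf[OF F d sol] no by blast
  then have z: "(\<lambda>_. 0) \<in> {J \<in> exponents n. mdeg n J \<le> ?M} - D" by (simp add: exponents_def mdeg_def)
  then obtain g where g: "nonsingular_combination n k F g" "tdegree n g \<le> ?M"
    "monomials g = {J \<in> exponents n. mdeg n J \<le> ?M} - D" using comb by blast
  then have "g (\<lambda>v. 0) \<noteq> \<infinity>" using z by (auto simp: monomials_def set_eq_iff)
  moreover have "real (tdegree n g) \<le> N" using g(2) N by linarith
  ultimately show "\<exists>g. nonsingular_combination n k F g \<and> real (tdegree n g) \<le> N \<and> g (\<lambda>v. 0) \<noteq> \<infinity>"
    using g(1) by blast
next
  assume "\<exists>g. nonsingular_combination n k F g \<and> real (tdegree n g) \<le> N \<and> g (\<lambda>v. 0) \<noteq> \<infinity>"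
  then obtain g where g: "nonsingular_combination n k F g" "g (\<lambda>v. 0) \<noteq> \<infinity>" by blast
  show "\<not> has_root_Rinf n k F"
  proof
    assume "has_root_Rinf n k F"
    then obtain U a where "\<And>i. i < k \<Longrightarrow> no_strict_minimum n (F i) U a" using has_root_Rinf_iff[of k n F] F by blast
    moreover have "(\<lambda>v. 0) \<in> face g U" using g(2) by (simp add: face_def monomials_def)
    ultimately show False using nonsingular_combination_excludes_root[OF F g(1)] by blast
  qed
qed

lemma tdegree_le_max_degree: "i < k \<Longrightarrow> tdegree n (F i) \<le> max_degree n k F"
  unfolding max_degree_def by (intro Max_ge) auto

theorem theorem11:
  "(\<forall>n k (F :: nat \<Rightarrow> tpoly). (\<forall>i<k. tpoly_R n (F i)) \<longrightarrow>
      (\<not> has_root_R n k F \<longleftrightarrow>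
        (\<exists>g. nonsingular_combination n k F g \<and>
             tdegree n g \<le> (n + 2) * (\<Sum>i<k. tdegree n (F i)))))
   \<and>
   (\<exists>p :: real poly poly poly. \<forall>n k (F :: nat \<Rightarrow> tpoly). (\<forall>i<k. tpoly_Rinf n (F i)) \<longrightarrow>
      (let d = max_degree n k F;
           N = poly3 p (real n) (real k) (real d) * (4 * real d) ^ min n k
       in \<not> has_root_Rinf n k F \<longleftrightarrow>
          (\<exists>g. nonsingular_combination n k F g \<and>
               real (tdegree n g) \<le> N \<and> g (\<lambda>v. 0) \<noteq> \<infinity>)))"
proof
  show "\<forall>n k (F :: nat \<Rightarrow> tpoly). (\<forall>i<k. tpoly_R n (F i)) \<longrightarrow>
      (\<not> has_root_R n k F \<longleftrightarrow>
        (\<exists>g. nonsingular_combination n k F g \<and>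
             tdegree n g \<le> (n + 2) * (\<Sum>i<k. tdegree n (F i))))"
    by (intro allI impI nullstellensatz_R) blast
  obtain p :: "real poly poly poly" where
    p: "\<And>n k d. real (macaulay_bound n k d) \<le> poly3 p (real n) (real k) (real d) * (4 * real d) ^ min n k"
    using macaulay_bound_le by blast
  show "\<exists>p :: real poly poly poly. \<forall>n k (F :: nat \<Rightarrow> tpoly). (\<forall>i<k. tpoly_Rinf n (F i)) \<longrightarrow>
      (let d = max_degree n k F;
           N = poly3 p (real n) (real k) (real d) * (4 * real d) ^ min n k
       in \<not> has_root_Rinf n k F \<longleftrightarrow>
          (\<exists>g. nonsingular_combination n k F g \<and>
               real (tdegree n g) \<le> N \<and> g (\<lambda>v. 0) \<noteq> \<infinity>))"
    unfolding Let_def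
    by (intro exI[of _ p] allI impI nullstellensatz_Rinf[OF _ tdegree_le_max_degree p]) blast+
qed

end
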